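(* Let $D$ be a $p\mathcal{BC}+$ action description with utility laws satisfying the standing assumptions, let $m$ be a nonnegative integer, and let $s_0\in\mathbf{S}$ be an initial state that is consistent with $D_{init}$. Then $$\underset{\pi \text{ a non-stationary policy}}{\mathrm{argmax}}\ E[U_{Tr(D,m)}(C_{\pi,m}\wedge\langle s_0\rangle^t)]\;=\;\underset{\pi\text{ a non-stationary policy}}{\mathrm{argmax}}\ ER_{M(D)}(\pi,s_0),$$ i.e. the set of policies $\pi:\mathbf{S}\times\{0,\dots,m-1\}\to\mathbf{A}$ maximizing the left objective equals the set of those maximizing the right objective.
   Context: Stable models. Formulas are propositional. A rule $F\leftarrow G$ is the implication $G\rightarrow F$; $\neg F$ is $F\rightarrow\bot$; the choice rule $\{A\}^{ch}$ for an atom $A$ is $A\leftarrow\neg\neg A$. An interpretation is identified with the set of atoms true in it. $I$ is a stable model of a finite set $\Pi$ of formulas if $I$ is a minimal (w.r.t. inclusion) model of the reduct $\Pi^I$ obtained by replacing every maximal subformula not satisfied by $I$ by $\bot$. LP$^{MLN}$. An LP$^{MLN}$ program $\Pi$ is a finite set of weighted rules $w:R$, with $w$ real (soft) or $w=\alpha$ (hard). $\Pi_I$ is the set of $w:R$ in $\Pi$ with $I\models R$. $SM[\Pi]$ is the set of $I$ that are stable models of $\Pi_I$ (weights dropped) and satisfy all hard rules; its elements are called the (probabilistic) stable models of $\Pi$. $W_\Pi(I)=\exp(\sum_{w:R\in\Pi_I,\,w \text{ soft}}w)$ for $I\in SM[\Pi]$ and $0$ otherwise; $P_\Pi(I)=W_\Pi(I)/\sum_{J\in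 SM[\Pi]}W_\Pi(J)$. For a formula $F$, $P_\Pi(F)=\sum_{I\models F}P_\Pi(I)$, and $P_\Pi(F\mid G)=P_\Pi(F\wedge G)/P_\Pi(G)$ (convention: $0$ if $P_\Pi(G)=0$). Utility atoms are atoms $\mathtt{utility}(u,\mathbf{t})$ with $u$ real and $\mathbf t$ a list of terms. $U_\Pi(I)=\sum_{\mathtt{utility}(u,\mathbf{t})\in I}u$, and for a formula $A$, $E[U_\Pi(A)]=\sum_{I\models A}U_\Pi(I)\,P_\Pi(I\mid A)$. Multi-valued probabilistic programs. Each constant $c$ has a finite domain $Dom(c)$; atoms are $c=v$, $v\in Dom(c)$. Boolean constants have domain $\{\text{true},\text{false}\}$. A multi-valued probabilistic program $\langle PF,\Pi\rangle$ consists of declarations $p_1::c=v_1\mid\dots\mid p_n::c=v_n$ (one for each probabilistic constant $c$) and rules $\Pi$ whose heads contain no probabilistic constants. It abbreviates the LP$^{MLN}$ program with soft rules $\ln(p_i):c=v_i$, hard rules for all of $\Pi$, and, for every constant $c$, hard constraints saying that $c$ has at most one value ($\bot\leftarrow c=v\wedge c=v'$ for $v\ne v'$) and at least one value ($\bot\leftarrow\neg\bigvee_v c=v$). $p\mathcal{BC}+$. Constants are divided into fluent constants $\sigma^{fl}$ (regular or statically determined), Boolean action constants $\sigma^{act}$, pf constants $\sigma^{pf}$ and initpf constants $\sigma^{initpf}$. Fluent formulas contain only fluent constants. An action description $D$ is a finite set of: static laws "caused $F$ if $G$" ($F,G$ fluent formulas); fluent dynamic laws "caused $F$ if $G$ after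 $H$" ($F,G$ fluent formulas, $F$ without statically determined constants, $H$ a formula without initpf constants); for each pf and each initpf constant $c$, a declaration "caused $c=\{v_1:p_1,\dots,v_n:p_n\}$" with $Dom(c)=\{v_1,\dots,v_n\}$, $0<p_i<1$, $\sum p_i=1$; initial static laws "initially $F$ if $G$" ($F$ a fluent atom, $G$ without action or pf constants); utility laws "reward $v$ if $F$ after $G$" ($v$ real, $F$ a fluent formula, $G$ containing only fluent and action constants). $i:F$ is $F$ with every constant $c$ replaced by the time-stamped constant $i:c$ (similarly for interpretations and sets). For $m\ge0$, $D_m$ is the multi-valued probabilistic program over the constants $i:c$ ($0\le i\le m$ for fluent $c$; $0\le i\le m-1$ for action and pf $c$) consisting of: $i:F\leftarrow i:G$ for each static law, $0\le i\le m$; $i{+}1:F\leftarrow(i{+}1:G)\wedge(i:H)$ for each fluent dynamic law, $0\le i\le m-1$; $\{0:c=v\}^{ch}$ for each regular fluent constant $c$ and $v\in Dom(c)$; $\{i:c=\text{true}\}^{ch}$, $\{i:c=\text{false}\}^{ch}$ for each action constant $c$, $0\le i\le m-1$; $p_1::i:c=v_1\mid\dots\mid p_n::i:c=v_n$ for each pf declaration, $0\le i\le m-1$; and the hard rules $\mathtt{utility}(v,i{+}1,id)\leftarrow(i{+}1:F)\wedge(i:G)$ for each utility law, $0\le i\le m-1$, where $id$ is a number unique to the rule. $D_{init}$, over $0:\sigma^{initpf}\cup0:\sigma^{fl}$, consists of $\bot\leftarrow\neg(0:F)\wedge0:G$ for each initial static law and $p_1::0:c=v_1\mid\dots\mid p_n::0:c=v_n$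 for each initpf declaration. $Tr(D,m)$ is the union of $D_m$ and $D_{init}$. An interpretation of part of the signature is a residual stable model of a program if it extends to a stable model of it. A state is an interpretation $s$ of $\sigma^{fl}$ such that $0:s$ is a residual stable model of $D_0$; $\mathbf{S}$ is the set of states. $\mathbf{A}$ is the set of interpretations $a$ of $\sigma^{act}$ such that $0:a$ is a residual stable model of $D_1$. A transition is a triple $\langle s,e,s'\rangle$ such that $0:s\cup0:e\cup1:s'$ is a residual stable model of $D_1$; $(\langle s,e,s'\rangle,pf)$ is a pf-transition if, in addition, $pf$ is a value assignment to $\sigma^{pf}$ and $0:s\cup 0:e\cup1:s'\cup0:pf$ (together with the utility atoms it determines) is a stable model of $D_1$. Standing assumptions on $D$: (1) in every transition $\langle s,e,s'\rangle$ at most one action constant is true in $e$; (2) for every state $s$, every assignment $e$ to $\sigma^{act}$ with at most one action true, and every assignment $pf$ to $\sigma^{pf}$, there is exactly one state $s'$ such that $(\langle s,e,s'\rangle,pf)$ is a pf-transition; (3) for every assignment $pf_{init}$ of $\sigma^{initpf}$ there is exactly one assignment $fl$ of $\sigma^{fl}$ such that $0:pf_{init}\cup0:fl$ is a stable model of $D_{init}\cup D_0$. For a state $s$ (or $a\in\mathbf{A}$), $i:s$ (or $i:a$) as a formula is the conjunction of the atoms $i:c=v$ it makes true; $\langle s_0\rangle^t$ is the formula $0:s_0$. A state $s$ is consistent with $D_{init}$ if some stable model of $D_{init}\cup D_0$ satisfies $0:s$. A (non-stationary) policy is a function $\pi:\mathbf{S}\times\{0,\dots,m-1\}\to\mathbf{A}$,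 and $C_{\pi,m}$ is the formula $\bigwedge_{s\in\mathbf{S},\,0\le i\le m-1}(i:s\rightarrow i:\pi(s,i))$. MDP. $M(D)=\langle\mathbf{S},\mathbf{A},T,R\rangle$ with $T(s,a,s')=P_{D_1}(1:s'\mid0:s\wedge0:a)$ and $R(s,a,s')=E[U_{D_1}(0:s\wedge0:a\wedge1:s')]$. For a policy $\pi$ and $s_0\in\mathbf S$, $$ER_{M(D)}(\pi,s_0)=\sum_{s_1,\dots,s_m\in\mathbf{S}}\Big(\sum_{i=0}^{m-1}R(s_i,\pi(s_i,i),s_{i+1})\Big)\Big(\prod_{i=0}^{m-1}T(s_i,\pi(s_i,i),s_{i+1})\Big).$$ *)

theory Defs
  imports Complex_Main "HOL-Library.FuncSet"
begin

section \<open>Stable models of propositional formulas\<close>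

datatype 'a form =
    Atom 'a
  | Bot
  | And "'a form" "'a form"
  | Or "'a form" "'a form"
  | Imp "'a form" "'a form"

abbreviation Neg :: "'a form \<Rightarrow> 'a form" where
  "Neg F \<equiv> Imp F Bot"

abbreviation Top :: "'a form" where
  "Top \<equiv> Imp Bot Bot"

text \<open>A rule \<open>F \<leftarrow> G\<close> is the formula \<open>Imp G F\<close>.\<close>

abbreviation rule_of :: "'a form \<Rightarrow> 'a form \<Rightarrow> 'a form" where
  "rule_of F G \<equiv> Imp G F"

abbreviation choice_rule :: "'a \<Rightarrow> 'a form" where
  "choice_rule a \<equiv> rule_of (Atom a) (Neg (Neg (Atom a)))"

text \<open>Conjunction and disjunction of a finite set of formulas, in some arbitrary but fixed order;
  only meaningful for finite sets.\<close>

definition BigAnd :: "'a form set \<Rightarrow> 'a form" where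
  "BigAnd A = foldr And (SOME xs. set xs = A \<and> distinct xs) Top"

definition BigOr :: "'a form set \<Rightarrow> 'a form" where
  "BigOr A = foldr Or (SOME xs. set xs = A \<and> distinct xs) Bot"

primrec sat :: "'a set \<Rightarrow> 'a form \<Rightarrow> bool" (infix "\<Turnstile>" 50) where
  "I \<Turnstile> Atom a \<longleftrightarrow> a \<in> I"
| "I \<Turnstile> Bot \<longleftrightarrow> False"
| "I \<Turnstile> And F G \<longleftrightarrow> I \<Turnstile> F \<and> I \<Turnstile> G"
| "I \<Turnstile> Or F G \<longleftrightarrow> I \<Turnstile> F \<or> I \<Turnstile> G"
| "I \<Turnstile> Imp F G \<longleftrightarrow> (I \<Turnstile> F \<longrightarrow> I \<Turnstile> G)"

primrec reduct :: "'a set \<Rightarrow> 'a form \<Rightarrow> 'a form" where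
  "reduct I (Atom a) = (if I \<Turnstile> Atom a then Atom a else Bot)"
| "reduct I Bot = Bot"
| "reduct I (And F G) = (if I \<Turnstile> And F G then And (reduct I F) (reduct I G) else Bot)"
| "reduct I (Or F G) = (if I \<Turnstile> Or F G then Or (reduct I F) (reduct I G) else Bot)"
| "reduct I (Imp F G) = (if I \<Turnstile> Imp F G then Imp (reduct I F) (reduct I G) else Bot)"

definition model :: "'a set \<Rightarrow> 'a form set \<Rightarrow> bool" where
  "model I \<Gamma> \<longleftrightarrow> (\<forall>F\<in>\<Gamma>. I \<Turnstile> F)"

definition stable_model :: "'a set \<Rightarrow> 'a form set \<Rightarrow> bool" where
  "stable_model I \<Gamma> \<longleftrightarrow>
     model I (reduct I ` \<Gamma>) \<and> \<not> (\<exists>J. J \<subset> I \<and> model J (reduct I ` \<Gamma>))"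

section \<open>LPMLN programs\<close>

datatype weight = Soft real | Hard

type_synonym 'a lpmln = "(weight \<times> 'a form) set"

definition SM :: "'a lpmln \<Rightarrow> 'a set set" where
  "SM P = {I. stable_model I {R. \<exists>w. (w, R) \<in> P \<and> I \<Turnstile> R} \<and> (\<forall>R. (Hard, R) \<in> P \<longrightarrow> I \<Turnstile> R)}"

definition weight_of :: "'a lpmln \<Rightarrow> 'a set \<Rightarrow> real" where
  "weight_of P I =
     (if I \<in> SM P then exp (\<Sum>(w, R) | (Soft w, R) \<in> P \<and> I \<Turnstile> R. w) else 0)"

definition prob_int :: "'a lpmln \<Rightarrow> 'a set \<Rightarrow> real" where
  "prob_int P I = weight_of P I / (\<Sum>J\<in>SM P. weight_of P J)"

text \<open>Sums over interpretations are restricted to \<^term>\<open>SM P\<close>, which is a finite set for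
  finite \<open>P\<close>: all other interpretations have probability 0.  Division by 0 yields 0.\<close>

definition prob_form :: "'a lpmln \<Rightarrow> 'a form \<Rightarrow> real" where
  "prob_form P F = (\<Sum>I | I \<in> SM P \<and> I \<Turnstile> F. prob_int P I)"

definition cond_prob_form :: "'a lpmln \<Rightarrow> 'a form \<Rightarrow> 'a form \<Rightarrow> real" where
  "cond_prob_form P F G = prob_form P (And F G) / prob_form P G"

definition cond_prob_int :: "'a lpmln \<Rightarrow> 'a set \<Rightarrow> 'a form \<Rightarrow> real" where
  "cond_prob_int P I G = (if I \<Turnstile> G then prob_int P I else 0) / prob_form P G"

section \<open>Utility\<close>

text \<open>Atoms \<open>k = v\<close> and \<open>utility(u, t)\<close>; the only terms needed in \<open>t\<close> are numbers.\<close>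

datatype ('k, 'v) atom = HasVal 'k 'v | Utility real "nat list"

definition utility_of :: "('k, 'v) atom set \<Rightarrow> real" where
  "utility_of I = (\<Sum>(u, t) | Utility u t \<in> I. u)"

definition expected_utility :: "('k, 'v) atom lpmln \<Rightarrow> ('k, 'v) atom form \<Rightarrow> real" where
  "expected_utility P A = (\<Sum>I | I \<in> SM P \<and> I \<Turnstile> A. utility_of I * cond_prob_int P I A)"

section \<open>Multi-valued probabilistic programs\<close>

text \<open>The LPMLN program abbreviated by the multi-valued probabilistic program over the constants
  \<open>K\<close> with domains \<open>dm\<close>, rules \<open>R\<close> and declarations \<open>PF\<close>.  An element \<open>(c, p)\<close> of \<open>PF\<close> is the
  declaration \<open>p v1 :: c = v1 | \<dots> | p vn :: c = vn\<close>, where \<open>v1, \<dots>, vn\<close> are the elements of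
  \<open>dm c\<close>.\<close>

definition mvpp ::
  "'k set \<Rightarrow> ('k \<Rightarrow> 'v set) \<Rightarrow> ('k \<times> ('v \<Rightarrow> real)) set \<Rightarrow> ('k, 'v) atom form set
     \<Rightarrow> ('k, 'v) atom lpmln" where
  "mvpp K dm PF R =
     {(Soft (ln (p v)), Atom (HasVal c v)) | c p v. (c, p) \<in> PF \<and> v \<in> dm c}
   \<union> {(Hard, F) | F. F \<in> R}
   \<union> {(Hard, rule_of Bot (And (Atom (HasVal c v)) (Atom (HasVal c v')))) | c v v'.
        c \<in> K \<and> v \<in> dm c \<and> v' \<in> dm c \<and> v \<noteq> v'}
   \<union> {(Hard, rule_of Bot (Neg (BigOr {Atom (HasVal c v) | v. v \<in> dm c}))) | c. c \<in> K}"

section \<open>Action descriptions\<close>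

datatype 'v val = TT | FF | Val 'v

text \<open>Formulas of the action language: atoms are pairs \<open>(c, v)\<close> standing for \<open>c = v\<close>.\<close>

type_synonym ('c, 'v) cform = "('c \<times> 'v val) form"

type_synonym ('c, 'v) interp = "('c \<times> 'v val) set"

text \<open>Tuples list the components of a law in reading order: \<open>(F, G)\<close> is "caused F if G",
  \<open>(F, G, H)\<close> is "caused F if G after H", \<open>((c, v), G)\<close> is "initially c = v if G", and
  \<open>(v, F, G)\<close> is "reward v if F after G".  \<open>prob c\<close> is the distribution declared for the pf or
  initpf constant \<open>c\<close>; \<open>uid\<close> assigns to each utility law its identifying number.\<close>

record ('c, 'v) action_desc =
  regular :: "'c set"
  statdet :: "'c set"
  actions :: "'c set"
  pfs :: "'c set"
  initpfs :: "'c set"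
  Dom :: "'c \<Rightarrow> 'v val set"
  prob :: "'c \<Rightarrow> 'v val \<Rightarrow> real"
  static_laws :: "(('c, 'v) cform \<times> ('c, 'v) cform) set"
  dynamic_laws :: "(('c, 'v) cform \<times> ('c, 'v) cform \<times> ('c, 'v) cform) set"
  initial_laws :: "(('c \<times> 'v val) \<times> ('c, 'v) cform) set"
  utility_laws :: "(real \<times> ('c, 'v) cform \<times> ('c, 'v) cform) set"
  uid :: "real \<times> ('c, 'v) cform \<times> ('c, 'v) cform \<Rightarrow> nat"

definition fluents :: "('c, 'v) action_desc \<Rightarrow> 'c set" where
  "fluents D = regular D \<union> statdet D"

definition atoms_over :: "('c, 'v) action_desc \<Rightarrow> 'c set \<Rightarrow> ('c \<times> 'v val) set" where
  "atoms_over D C = {(c, v). c \<in> C \<and> v \<in> Dom D c}"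

definition form_over :: "('c, 'v) action_desc \<Rightarrow> 'c set \<Rightarrow> ('c, 'v) cform \<Rightarrow> bool" where
  "form_over D C F \<longleftrightarrow> set_form F \<subseteq> atoms_over D C"

definition assignments :: "('c, 'v) action_desc \<Rightarrow> 'c set \<Rightarrow> ('c, 'v) interp set" where
  "assignments D C = {J. J \<subseteq> atoms_over D C \<and> (\<forall>c\<in>C. \<exists>!v. (c, v) \<in> J)}"

definition wf_action_desc :: "('c, 'v) action_desc \<Rightarrow> bool" where
  "wf_action_desc D \<longleftrightarrow>
     finite (fluents D \<union> actions D \<union> pfs D \<union> initpfs D) \<and>
     regular D \<inter> statdet D = {} \<and>
     fluents D \<inter> actions D = {} \<and> fluents D \<inter> pfs D = {} \<and> fluents D \<inter> initpfs D = {} \<and>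
     actions D \<inter> pfs D = {} \<and> actions D \<inter> initpfs D = {} \<and> pfs D \<inter> initpfs D = {} \<and>
     (\<forall>c \<in> fluents D \<union> actions D \<union> pfs D \<union> initpfs D. finite (Dom D c)) \<and>
     (\<forall>c \<in> actions D. Dom D c = {TT, FF}) \<and>
     (\<forall>c \<in> pfs D \<union> initpfs D.
        (\<forall>v \<in> Dom D c. 0 < prob D c v \<and> prob D c v < 1) \<and> (\<Sum>v\<in>Dom D c. prob D c v) = 1) \<and>
     finite (static_laws D) \<and>
     (\<forall>(F, G) \<in> static_laws D. form_over D (fluents D) F \<and> form_over D (fluents D) G) \<and>
     finite (dynamic_laws D) \<and>
     (\<forall>(F, G, H) \<in> dynamic_laws D. form_over D (regular D) F \<and> form_over D (fluents D) G \<and>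
        form_over D (fluents D \<union> actions D \<union> pfs D) H) \<and>
     finite (initial_laws D) \<and>
     (\<forall>(A, G) \<in> initial_laws D. A \<in> atoms_over D (fluents D) \<and>
        form_over D (fluents D \<union> initpfs D) G) \<and>
     finite (utility_laws D) \<and>
     (\<forall>(v, F, G) \<in> utility_laws D. form_over D (fluents D) F \<and>
        form_over D (fluents D \<union> actions D) G) \<and>
     inj_on (uid D) (utility_laws D)"

section \<open>Translation into multi-valued probabilistic programs\<close>

type_synonym ('c, 'v) tatom = "(nat \<times> 'c, 'v val) atom"

fun stamp_atom :: "nat \<Rightarrow> 'c \<times> 'v val \<Rightarrow> ('c, 'v) tatom" where
  "stamp_atom i (c, v) = HasVal (i, c) v"

abbreviation stamp_form :: "nat \<Rightarrow> ('c, 'v) cform \<Rightarrow> ('c, 'v) tatom form" where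
  "stamp_form i F \<equiv> map_form (stamp_atom i) F"

abbreviation stamp_set :: "nat \<Rightarrow> ('c, 'v) interp \<Rightarrow> ('c, 'v) tatom set" where
  "stamp_set i J \<equiv> stamp_atom i ` J"

definition stamp_conj :: "nat \<Rightarrow> ('c, 'v) interp \<Rightarrow> ('c, 'v) tatom form" where
  "stamp_conj i J = BigAnd (Atom ` stamp_set i J)"

definition tDom :: "('c, 'v) action_desc \<Rightarrow> nat \<times> 'c \<Rightarrow> 'v val set" where
  "tDom D = (\<lambda>(i, c). Dom D c)"

definition D_rules :: "('c, 'v) action_desc \<Rightarrow> nat \<Rightarrow> ('c, 'v) tatom form set" where
  "D_rules D m =
     {rule_of (stamp_form i F) (stamp_form i G) | i F G. i \<le> m \<and> (F, G) \<in> static_laws D}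
   \<union> {rule_of (stamp_form (i + 1) F) (And (stamp_form (i + 1) G) (stamp_form i H)) | i F G H.
        i < m \<and> (F, G, H) \<in> dynamic_laws D}
   \<union> {choice_rule (HasVal (0, c) v) | c v. c \<in> regular D \<and> v \<in> Dom D c}
   \<union> {choice_rule (HasVal (i, c) v) | i c v. i < m \<and> c \<in> actions D \<and> v \<in> {TT, FF}}
   \<union> {rule_of (Atom (Utility v [i + 1, uid D (v, F, G)]))
              (And (stamp_form (i + 1) F) (stamp_form i G)) | i v F G.
        i < m \<and> (v, F, G) \<in> utility_laws D}"

definition D_prog :: "('c, 'v) action_desc \<Rightarrow> nat \<Rightarrow> ('c, 'v) tatom lpmln" where
  "D_prog D m =
     mvpp ({(i, c). i \<le> m \<and> c \<in> fluents D} \<union> {(i, c). i < m \<and> c \<in> actions D \<union> pfs D})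
       (tDom D)
       {((i, c), prob D c) | i c. i < m \<and> c \<in> pfs D}
       (D_rules D m)"

definition D_init :: "('c, 'v) action_desc \<Rightarrow> ('c, 'v) tatom lpmln" where
  "D_init D =
     mvpp {(0, c) | c. c \<in> initpfs D \<union> fluents D}
       (tDom D)
       {((0, c), prob D c) | c. c \<in> initpfs D}
       {rule_of Bot (And (Neg (stamp_form 0 (Atom A))) (stamp_form 0 G)) | A G.
          (A, G) \<in> initial_laws D}"

definition Tr :: "('c, 'v) action_desc \<Rightarrow> nat \<Rightarrow> ('c, 'v) tatom lpmln" where
  "Tr D m = D_prog D m \<union> D_init D"

section \<open>States, actions and transitions\<close>

definition residual_stable_model :: "'a set \<Rightarrow> 'a set \<Rightarrow> 'a lpmln \<Rightarrow> bool" where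
  "residual_stable_model \<sigma> J P \<longleftrightarrow> J \<subseteq> \<sigma> \<and> (\<exists>I\<in>SM P. I \<inter> \<sigma> = J)"

definition states :: "('c, 'v) action_desc \<Rightarrow> ('c, 'v) interp set" where
  "states D = {s. s \<subseteq> atoms_over D (fluents D) \<and>
     residual_stable_model (stamp_set 0 (atoms_over D (fluents D))) (stamp_set 0 s) (D_prog D 0)}"

definition act_interps :: "('c, 'v) action_desc \<Rightarrow> ('c, 'v) interp set" where
  "act_interps D = {a. a \<subseteq> atoms_over D (actions D) \<and>
     residual_stable_model (stamp_set 0 (atoms_over D (actions D))) (stamp_set 0 a) (D_prog D 1)}"

definition transition ::
  "('c, 'v) action_desc \<Rightarrow> ('c, 'v) interp \<Rightarrow> ('c, 'v) interp \<Rightarrow> ('c, 'v) interp \<Rightarrow> bool" where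
  "transition D s e s' \<longleftrightarrow>
     s \<subseteq> atoms_over D (fluents D) \<and> e \<subseteq> atoms_over D (actions D) \<and> s' \<subseteq> atoms_over D (fluents D) \<and>
     residual_stable_model
       (stamp_set 0 (atoms_over D (fluents D)) \<union> stamp_set 0 (atoms_over D (actions D))
          \<union> stamp_set 1 (atoms_over D (fluents D)))
       (stamp_set 0 s \<union> stamp_set 0 e \<union> stamp_set 1 s')
       (D_prog D 1)"

text \<open>The utility atoms of \<^term>\<open>D_prog D 1\<close> determined by an interpretation of the time-stamped
  constants: heads of the utility rules whose bodies hold.\<close>

definition determined_utility ::
  "('c, 'v) action_desc \<Rightarrow> ('c, 'v) tatom set \<Rightarrow> ('c, 'v) tatom set" where
  "determined_utility D I =
     {Utility v [1, uid D (v, F, G)] | v F G. (v, F, G) \<in> utility_laws D \<and>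
        I \<Turnstile> And (stamp_form 1 F) (stamp_form 0 G)}"

definition pf_transition ::
  "('c, 'v) action_desc \<Rightarrow> ('c, 'v) interp \<Rightarrow> ('c, 'v) interp \<Rightarrow> ('c, 'v) interp
     \<Rightarrow> ('c, 'v) interp \<Rightarrow> bool" where
  "pf_transition D s e s' pf \<longleftrightarrow>
     transition D s e s' \<and> pf \<in> assignments D (pfs D) \<and>
     (let I = stamp_set 0 s \<union> stamp_set 0 e \<union> stamp_set 1 s' \<union> stamp_set 0 pf
      in I \<union> determined_utility D I \<in> SM (D_prog D 1))"

definition at_most_one_true :: "('c, 'v) interp \<Rightarrow> bool" where
  "at_most_one_true e \<longleftrightarrow> (\<forall>c c'. (c, TT) \<in> e \<and> (c', TT) \<in> e \<longrightarrow> c = c')"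

definition standing_assumptions :: "('c, 'v) action_desc \<Rightarrow> bool" where
  "standing_assumptions D \<longleftrightarrow>
     (\<forall>s e s'. transition D s e s' \<longrightarrow> at_most_one_true e) \<and>
     (\<forall>s\<in>states D. \<forall>e\<in>assignments D (actions D). \<forall>pf\<in>assignments D (pfs D).
        at_most_one_true e \<longrightarrow> (\<exists>!s'. s' \<in> states D \<and> pf_transition D s e s' pf)) \<and>
     (\<forall>pfi\<in>assignments D (initpfs D). \<exists>!fl. fl \<in> assignments D (fluents D) \<and>
        stamp_set 0 pfi \<union> stamp_set 0 fl \<in> SM (D_init D \<union> D_prog D 0))"

definition consistent_with_init :: "('c, 'v) action_desc \<Rightarrow> ('c, 'v) interp \<Rightarrow> bool" where
  "consistent_with_init D s \<longleftrightarrow> (\<exists>I \<in> SM (D_init D \<union> D_prog D 0). I \<Turnstile> stamp_conj 0 s)"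

section \<open>Policies and Markov decision processes\<close>

record ('s, 'a) mdp =
  mdp_states :: "'s set"
  mdp_actions :: "'a set"
  mdp_trans :: "'s \<Rightarrow> 'a \<Rightarrow> 's \<Rightarrow> real"
  mdp_reward :: "'s \<Rightarrow> 'a \<Rightarrow> 's \<Rightarrow> real"

definition mdp_of :: "('c, 'v) action_desc \<Rightarrow> (('c, 'v) interp, ('c, 'v) interp) mdp" where
  "mdp_of D =
     \<lparr> mdp_states = states D,
       mdp_actions = act_interps D,
       mdp_trans = (\<lambda>s a s'. cond_prob_form (D_prog D 1) (stamp_conj 1 s')
                               (And (stamp_conj 0 s) (stamp_conj 0 a))),
       mdp_reward = (\<lambda>s a s'. expected_utility (D_prog D 1)
                               (And (And (stamp_conj 0 s) (stamp_conj 0 a)) (stamp_conj 1 s'))) \<rparr>"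

definition ER :: "('s, 'a) mdp \<Rightarrow> nat \<Rightarrow> ('s \<times> nat \<Rightarrow> 'a) \<Rightarrow> 's \<Rightarrow> real" where
  "ER M m \<pi> s0 =
     (\<Sum>s | s \<in> {0..m} \<rightarrow>\<^sub>E mdp_states M \<and> s 0 = s0.
        (\<Sum>i<m. mdp_reward M (s i) (\<pi> (s i, i)) (s (i + 1))) *
        (\<Prod>i<m. mdp_trans M (s i) (\<pi> (s i, i)) (s (i + 1))))"

definition policies ::
  "('c, 'v) action_desc \<Rightarrow> nat \<Rightarrow> (('c, 'v) interp \<times> nat \<Rightarrow> ('c, 'v) interp) set" where
  "policies D m = (states D \<times> {..<m}) \<rightarrow>\<^sub>E act_interps D"

definition policy_form ::
  "('c, 'v) action_desc \<Rightarrow> nat \<Rightarrow> (('c, 'v) interp \<times> nat \<Rightarrow> ('c, 'v) interp)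
     \<Rightarrow> ('c, 'v) tatom form" where
  "policy_form D m \<pi> =
     BigAnd {Imp (stamp_conj i s) (stamp_conj i (\<pi> (s, i))) | s i. s \<in> states D \<and> i < m}"

definition argmax :: "('p \<Rightarrow> real) \<Rightarrow> 'p set \<Rightarrow> 'p set" where
  "argmax f P = {x. is_arg_max f (\<lambda>y. y \<in> P) x}"

end

theory Submission
  imports Defs
begin

text \<open>
  The two objectives agree for every policy, not only their maximisers.  A stable model of
  \<^term>\<open>Tr D m\<close> is the same thing as a run: an assignment of the initpf constants, a state per time
  point, and an assignment of the action and pf constants per step.  Minimality of the
  whole model amounts to minimality of the fluents at time 0 together with, for each later time
  point, minimality of the fluents relative to the preceding slice: a smaller model of the reduct
  agrees with the given one slice by slice by induction on time, and conversely a slice that can be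
  shrunk can be shrunk in place, since heads of later rules are untouched.  The weight of a run is a
  product over the pf constants, so summing over pf assignments first turns the conditional
  expectation into a sum over state paths of the total utility times the product of the one-step
  probabilities.  The latter are the transition probabilities of the MDP, the former is the sum
  of its rewards wherever that product is nonzero, and the mass of the initpf
  assignments leading to the initial state cancels.
\<close>

section \<open>Reducts\<close>

text \<open>The initial mass cancels only because the normaliser of the conditional expectation does
  not depend on the policy. For a state and an element of \<open>act_interps D\<close>, the
  successor probabilities sum to 1: a pf assignment has exactly one successor, provided that at most
  one action is true. That proviso holds for every value of a policy, because an element of
  \<open>act_interps D\<close> is read off a stable model of \<open>D_prog D 1\<close> and hence off
  a transition. Products along paths then sum to 1 too, and consistency of \<open>s0\<close> makes
  the remaining factor positive.

  Three restrictions on laws shape the slicewise analysis. Heads of dynamic laws avoid statically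
  determined constants, so a slice reached by a step is again a state although later slices have no
  choice rules for fluents. The condition \<open>H\<close> of a dynamic law does not see initpf
  constants, so a step means the same in \<open>Tr D m\<close> and in \<open>D_prog D 1\<close>.
  Utility atoms carry a time and a law number, so equal rewards do not merge in the set of atoms and
  total utility is additive over time.\<close>

lemma sat_reduct_self [simp]: "I \<Turnstile> reduct I F \<longleftrightarrow> I \<Turnstile> F"
  by (induction F) auto

text \<open>Whatever \<open>I\<close> falsifies has become \<open>Bot\<close>, which no
  \<open>J\<close> satisfies. This settles constraints and rule bodies without any relation between
  \<open>J\<close> and \<open>I\<close>.\<close>

lemma sat_reductD: "J \<Turnstile> reduct I F \<Longrightarrow> I \<Turnstile> F"
  by (induction F) (auto split: if_splits)

lemma sat_reduct_Imp_iff: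
  "J \<Turnstile> reduct I (Imp G F) \<longleftrightarrow> I \<Turnstile> Imp G F \<and> (J \<Turnstile> reduct I G \<longrightarrow> J \<Turnstile> reduct I F)"
  by auto

text \<open>The test on \<open>I\<close> made by the reduct is implied by the two conjuncts. For
  implications it is not, so there it stays explicit.\<close>

lemma sat_reduct_And_iff:
  "J \<Turnstile> reduct I (And F G) \<longleftrightarrow> J \<Turnstile> reduct I F \<and> J \<Turnstile> reduct I G"
  using sat_reductD[of J I F] sat_reductD[of J I G] by auto

text \<open>Serves to cut interpretations down to the vocabulary of a law. Both \<open>J\<close> and
  \<open>I\<close> have to be matched, since \<open>I\<close> decides which subformulas become
  \<open>Bot\<close>.\<close>

lemma sat_reduct_cong:
  assumes "\<And>a. a \<in> set_form F \<Longrightarrow> (a \<in> J \<longleftrightarrow> a \<in> J') \<and> (a \<in> I \<longleftrightarrow> a \<in> I')"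
  shows "J \<Turnstile> reduct I F \<longleftrightarrow> J' \<Turnstile> reduct I' F"
proof -
  have sat: "I \<Turnstile> F \<longleftrightarrow> I' \<Turnstile> F" if "\<And>a. a \<in> set_form F \<Longrightarrow> (a \<in> I \<longleftrightarrow> a \<in> I')" for F
    using that by (induction F) auto
  show ?thesis
    using assms
  proof (induction F)
    case (And F G)
    then show ?case unfolding sat_reduct_And_iff by simp
  next
    case (Or F G)
    then show ?case using sat[of "Or F G"] by simp
  next
    case (Imp F G)
    then show ?case unfolding sat_reduct_Imp_iff using sat[of "Imp F G"] by simp
  qed auto
qed

text \<open>Stamping is moved from the formula to the interpretations, so that laws can be evaluated
  in unstamped slices.\<close>

lemma sat_reduct_map_form:
  "J \<Turnstile> reduct I (map_form f F) \<longleftrightarrow> f -` J \<Turnstile> reduct (f -` I) F"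
proof -
  have "I \<Turnstile> map_form f F \<longleftrightarrow> f -` I \<Turnstile> F" for F
    by (induction F) auto
  then show ?thesis
    by (induction F) (auto simp: sat_reduct_And_iff)
qed

lemma sat_map_form: "I \<Turnstile> map_form f F \<longleftrightarrow> f -` I \<Turnstile> F"
  using sat_reduct_map_form[of I I f F] by simp

lemma sat_BigAnd:
  assumes "finite A"
  shows "I \<Turnstile> BigAnd A \<longleftrightarrow> (\<forall>F\<in>A. I \<Turnstile> F)"
proof -
  define xs where "xs = (SOME xs. set xs = A \<and> distinct xs)"
  have "set xs = A"
    unfolding xs_def by (rule someI2_ex) (use finite_distinct_list[OF assms] in auto)
  moreover have "I \<Turnstile> foldr And ys Top \<longleftrightarrow> (\<forall>F\<in>set ys. I \<Turnstile> F)" for ys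
    by (induction ys) auto
  ultimately show ?thesis
    by (simp add: BigAnd_def xs_def[symmetric])
qed

lemma sat_BigOr:
  assumes "finite A"
  shows "I \<Turnstile> BigOr A \<longleftrightarrow> (\<exists>F\<in>A. I \<Turnstile> F)"
proof -
  define xs where "xs = (SOME xs. set xs = A \<and> distinct xs)"
  have "set xs = A"
    unfolding xs_def by (rule someI2_ex) (use finite_distinct_list[OF assms] in auto)
  moreover have "I \<Turnstile> foldr Or ys Bot \<longleftrightarrow> (\<exists>F\<in>set ys. I \<Turnstile> F)" for ys
    by (induction ys) auto
  ultimately show ?thesis
    by (simp add: BigOr_def xs_def[symmetric])
qed

section \<open>Stable models of multi-valued probabilistic programs\<close>

text \<open>Constraints never constrain a model of the reduct, and a satisfied soft atom is a fact.\<close>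

lemma SM_mvpp_iff:
  assumes fin: "\<And>c. c \<in> K \<Longrightarrow> finite (dm c)"
  shows "I \<in> SM (mvpp K dm PF R) \<longleftrightarrow>
     (\<forall>F\<in>R. I \<Turnstile> F) \<and> (\<forall>c\<in>K. \<exists>!v. v \<in> dm c \<and> HasVal c v \<in> I) \<and>
     (\<forall>J\<subseteq>I. (\<forall>c p v. (c, p) \<in> PF \<longrightarrow> v \<in> dm c \<longrightarrow> HasVal c v \<in> I \<longrightarrow> HasVal c v \<in> J) \<longrightarrow>
        (\<forall>F\<in>R. J \<Turnstile> reduct I F) \<longrightarrow> J = I)"
proof -
  let ?P = "mvpp K dm PF R"
  have ex: "I \<Turnstile> BigOr {Atom (HasVal c v) | v. v \<in> dm c} \<longleftrightarrow> (\<exists>v\<in>dm c. HasVal c v \<in> I)"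
    if "c \<in> K" for c
    using fin[OF that] by (subst sat_BigOr) auto
  have hard: "(\<forall>F. (Hard, F) \<in> ?P \<longrightarrow> I \<Turnstile> F) \<longleftrightarrow>
      (\<forall>F\<in>R. I \<Turnstile> F) \<and> (\<forall>c\<in>K. \<exists>!v. v \<in> dm c \<and> HasVal c v \<in> I)" (is "?L \<longleftrightarrow> ?S")
  proof
    assume L: ?L
    have "\<exists>v\<in>dm c. HasVal c v \<in> I" if "c \<in> K" for c
    proof -
      have "(Hard, rule_of Bot (Neg (BigOr {Atom (HasVal c v) | v. v \<in> dm c}))) \<in> ?P"
        using that by (auto simp: mvpp_def)
      then show ?thesis using L ex[OF that] by fastforce
    qed
    moreover have "v = v'" if "c \<in> K" "v \<in> dm c" "v' \<in> dm c" "HasVal c v \<in> I" "HasVal c v' \<in> I"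
      for c v v'
    proof (rule ccontr)
      assume "v \<noteq> v'"
      then have "(Hard, rule_of Bot (And (Atom (HasVal c v)) (Atom (HasVal c v')))) \<in> ?P"
        using that by (auto simp: mvpp_def)
      then show False using L that by fastforce
    qed
    moreover have "\<forall>F\<in>R. I \<Turnstile> F"
      using L by (auto simp: mvpp_def)
    ultimately show ?S by blast
  next
    assume S: ?S
    show ?L
    proof (intro allI impI)
      fix F assume "(Hard, F) \<in> ?P"
      then consider "F \<in> R"
        | c v v' where "F = rule_of Bot (And (Atom (HasVal c v)) (Atom (HasVal c v')))"
            "c \<in> K" "v \<in> dm c" "v' \<in> dm c" "v \<noteq> v'"
        | c where "F = rule_of Bot (Neg (BigOr {Atom (HasVal c v) | v. v \<in> dm c}))" "c \<in> K"
        by (auto simp: mvpp_def)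
      then show "I \<Turnstile> F"
      proof cases
        case 1
        then show ?thesis using S by blast
      next
        case 2
        then show ?thesis using S by auto
      next
        case 3
        then show ?thesis using S ex[of c] by auto
      qed
    qed
  qed
  have red: "model J (reduct I ` {F. \<exists>w. (w, F) \<in> ?P \<and> I \<Turnstile> F}) \<longleftrightarrow>
      (\<forall>c p v. (c, p) \<in> PF \<longrightarrow> v \<in> dm c \<longrightarrow> HasVal c v \<in> I \<longrightarrow> HasVal c v \<in> J) \<and>
      (\<forall>F\<in>R. J \<Turnstile> reduct I F)" (is "?M \<longleftrightarrow> ?S1 \<and> ?S2") if S: ?S for J
  proof
    assume M: ?M
    have M': "J \<Turnstile> reduct I F" if "(w, F) \<in> ?P" "I \<Turnstile> F" for w F
      using M that unfolding model_def by blast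
    have ?S1
    proof (intro allI impI)
      fix c p v assume "(c, p) \<in> PF" "v \<in> dm c" "HasVal c v \<in> I"
      moreover from this have "(Soft (ln (p v)), Atom (HasVal c v)) \<in> ?P"
        unfolding mvpp_def by blast
      ultimately show "HasVal c v \<in> J" using M' by fastforce
    qed
    moreover have ?S2
    proof
      fix F assume "F \<in> R"
      moreover from this have "(Hard, F) \<in> ?P"
        unfolding mvpp_def by blast
      ultimately show "J \<Turnstile> reduct I F" using M' S by blast
    qed
    ultimately show "?S1 \<and> ?S2" ..
  next
    assume S12: "?S1 \<and> ?S2"
    \<comment> \<open>\<open>I\<close> falsifies the body \<open>G\<close>, so the reduct of
      \<open>G\<close> is unsatisfiable.\<close>
    have constr: "J \<Turnstile> reduct I (Imp G Bot)" if "I \<Turnstile> Imp G Bot" for G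
      using that sat_reductD[of J I G] by auto
    have "J \<Turnstile> reduct I F" if "(w, F) \<in> ?P" and F: "I \<Turnstile> F" for w F
    proof -
      from that(1) consider "F \<in> R" | G where "F = Imp G Bot"
        | c p v where "F = Atom (HasVal c v)" "(c, p) \<in> PF" "v \<in> dm c"
        by (auto simp: mvpp_def)
      then show ?thesis
      proof cases
        case 1
        then show ?thesis using S12 by blast
      next
        case 2
        then show ?thesis using constr F by blast
      next
        case 3
        then show ?thesis using S12 F by auto
      qed
    qed
    then show ?M
      unfolding model_def by blast
  qed
  have self: "model I (reduct I ` {F. \<exists>w. (w, F) \<in> ?P \<and> I \<Turnstile> F})"
    by (auto simp: model_def)
  have stable: "stable_model I {F. \<exists>w. (w, F) \<in> ?P \<and> I \<Turnstile> F} \<longleftrightarrow>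
     (\<forall>J\<subseteq>I. model J (reduct I ` {F. \<exists>w. (w, F) \<in> ?P \<and> I \<Turnstile> F}) \<longrightarrow> J = I)"
    unfolding stable_model_def using self by blast
  have SM: "I \<in> SM ?P \<longleftrightarrow> ?S \<and> stable_model I {F. \<exists>w. (w, F) \<in> ?P \<and> I \<Turnstile> F}"
    unfolding SM_def mem_Collect_eq hard by (rule conj_commute)
  show ?thesis
  proof (cases ?S)
    case True
    show ?thesis
      unfolding SM stable red[OF True] imp_conjL conj_assoc ..
  next
    case False
    then show ?thesis unfolding SM by blast
  qed
qed

section \<open>The stable models of the translation\<close>

text \<open>Holds componentwise because both programs share the domain function; it lets the union
  \<open>Tr D m\<close> be analysed as a single program.\<close>

lemma mvpp_Un: "mvpp K dm PF R \<union> mvpp K' dm PF' R' = mvpp (K \<union> K') dm (PF \<union> PF') (R \<union> R')"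
proof -
  have "x \<in> mvpp K dm PF R \<or> x \<in> mvpp K' dm PF' R' \<longleftrightarrow>
      x \<in> mvpp (K \<union> K') dm (PF \<union> PF') (R \<union> R')" for x
    unfolding mvpp_def Un_iff mem_Collect_eq
    by (simp only: conj_disj_distribL conj_disj_distribR ex_disj_distrib disj_ac)
  then show ?thesis by blast
qed

definition Tr_consts :: "('c, 'v) action_desc \<Rightarrow> nat \<Rightarrow> (nat \<times> 'c) set" where
  "Tr_consts D m = {(i, c). i \<le> m \<and> c \<in> fluents D} \<union> {(i, c). i < m \<and> c \<in> actions D \<union> pfs D}
     \<union> {(0, c) | c. c \<in> initpfs D \<union> fluents D}"

definition Tr_decls ::
  "('c, 'v) action_desc \<Rightarrow> nat \<Rightarrow> ((nat \<times> 'c) \<times> ('v val \<Rightarrow> real)) set" where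
  "Tr_decls D m = {((i, c), prob D c) | i c. i < m \<and> c \<in> pfs D}
     \<union> {((0, c), prob D c) | c. c \<in> initpfs D}"

definition Tr_rules :: "('c, 'v) action_desc \<Rightarrow> nat \<Rightarrow> ('c, 'v) tatom form set" where
  "Tr_rules D m = D_rules D m
     \<union> {rule_of Bot (And (Neg (stamp_form 0 (Atom A))) (stamp_form 0 G)) | A G.
          (A, G) \<in> initial_laws D}"

lemma Tr_eq_mvpp: "Tr D m = mvpp (Tr_consts D m) (tDom D) (Tr_decls D m) (Tr_rules D m)"
  unfolding Tr_def D_prog_def D_init_def mvpp_Un Tr_consts_def Tr_decls_def Tr_rules_def ..

section \<open>Rules evaluated on time slices\<close>

abbreviation slice :: "nat \<Rightarrow> ('c, 'v) tatom set \<Rightarrow> ('c, 'v) interp" where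
  "slice i I \<equiv> stamp_atom i -` I"

lemma in_stamp_set_iff [simp]: "HasVal (i, c) v \<in> stamp_set j x \<longleftrightarrow> i = j \<and> (c, v) \<in> x"
  by (force simp: image_iff)

lemma Utility_notin_stamp_set [simp]: "Utility u t \<notin> stamp_set j x"
  by (auto simp: image_iff)

lemma ball_Tr_rules_iff:
  "(\<forall>R\<in>Tr_rules D m. P R) \<longleftrightarrow>
     (\<forall>i\<le>m. \<forall>(F, G)\<in>static_laws D. P (rule_of (stamp_form i F) (stamp_form i G))) \<and>
     (\<forall>i<m. \<forall>(F, G, H)\<in>dynamic_laws D.
        P (rule_of (stamp_form (Suc i) F) (And (stamp_form (Suc i) G) (stamp_form i H)))) \<and>
     (\<forall>c\<in>regular D. \<forall>v\<in>Dom D c. P (choice_rule (HasVal (0, c) v))) \<and>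
     (\<forall>i<m. \<forall>c\<in>actions D. \<forall>v\<in>{TT, FF}. P (choice_rule (HasVal (i, c) v))) \<and>
     (\<forall>i<m. \<forall>(v, F, G)\<in>utility_laws D. P (rule_of (Atom (Utility v [Suc i, uid D (v, F, G)]))
        (And (stamp_form (Suc i) F) (stamp_form i G)))) \<and>
     (\<forall>(A, G)\<in>initial_laws D. P (rule_of Bot (And (Neg (stamp_form 0 (Atom A))) (stamp_form 0 G))))"
  unfolding Tr_rules_def D_rules_def Suc_eq_plus1 ball_Un conj_assoc
  by (intro arg_cong2[where f = "(\<and>)"];
      simp only: Ball_def mem_Collect_eq split_paired_All prod.case; fast)

text \<open>Choice rules disappear, being classical tautologies, and stamped formulas turn into
  formulas about slices.\<close>

lemma sat_Tr_rules_iff: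
  "(\<forall>R\<in>Tr_rules D m. I \<Turnstile> R) \<longleftrightarrow>
     (\<forall>i\<le>m. \<forall>(F, G)\<in>static_laws D. slice i I \<Turnstile> Imp G F) \<and>
     (\<forall>i<m. \<forall>(F, G, H)\<in>dynamic_laws D. slice i I \<Turnstile> H \<longrightarrow> slice (Suc i) I \<Turnstile> Imp G F) \<and>
     (\<forall>i<m. \<forall>(v, F, G)\<in>utility_laws D. slice (Suc i) I \<Turnstile> F \<longrightarrow> slice i I \<Turnstile> G \<longrightarrow>
        Utility v [Suc i, uid D (v, F, G)] \<in> I) \<and>
     (\<forall>(A, G)\<in>initial_laws D. slice 0 I \<Turnstile> G \<longrightarrow> A \<in> slice 0 I)"
proof -
  have "I \<Turnstile> choice_rule a" for a
    by simp
  moreover have "(\<forall>i<m. \<forall>(F, G, H)\<in>dynamic_laws D.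
        I \<Turnstile> rule_of (stamp_form (Suc i) F) (And (stamp_form (Suc i) G) (stamp_form i H)))
     \<longleftrightarrow> (\<forall>i<m. \<forall>(F, G, H)\<in>dynamic_laws D. slice i I \<Turnstile> H \<longrightarrow> slice (Suc i) I \<Turnstile> Imp G F)"
    by (simp only: sat_map_form sat.simps) blast
  moreover have "(\<forall>i<m. \<forall>(v, F, G)\<in>utility_laws D.
        I \<Turnstile> rule_of (Atom (Utility v [Suc i, uid D (v, F, G)]))
          (And (stamp_form (Suc i) F) (stamp_form i G)))
     \<longleftrightarrow> (\<forall>i<m. \<forall>(v, F, G)\<in>utility_laws D. slice (Suc i) I \<Turnstile> F \<longrightarrow> slice i I \<Turnstile> G \<longrightarrow>
        Utility v [Suc i, uid D (v, F, G)] \<in> I)"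
    by (simp only: sat_map_form sat.simps) blast
  moreover have "(\<forall>(A, G)\<in>initial_laws D.
        I \<Turnstile> rule_of Bot (And (Neg (stamp_form 0 (Atom A))) (stamp_form 0 G)))
     \<longleftrightarrow> (\<forall>(A, G)\<in>initial_laws D. slice 0 I \<Turnstile> G \<longrightarrow> A \<in> slice 0 I)"
    by (simp only: sat_map_form sat.simps) blast
  ultimately show ?thesis
    unfolding ball_Tr_rules_iff by (simp only: sat_map_form sat.simps simp_thms ball_triv)
qed

text \<open>Choice rules, vacuous classically, now act as facts for the atoms true in
  \<open>I\<close>; initial laws are constraints whose bodies are false in \<open>I\<close>, so they
  drop out. Since \<open>I\<close> satisfies every rule, the outer test of the reduct always
  succeeds.\<close>

lemma reduct_Tr_rules_iff:
  assumes "J \<subseteq> I" and sat: "\<forall>R\<in>Tr_rules D m. I \<Turnstile> R"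
  shows "(\<forall>R\<in>Tr_rules D m. J \<Turnstile> reduct I R) \<longleftrightarrow>
     (\<forall>i\<le>m. \<forall>(F, G)\<in>static_laws D. slice i J \<Turnstile> reduct (slice i I) (Imp G F)) \<and>
     (\<forall>i<m. \<forall>(F, G, H)\<in>dynamic_laws D. slice i J \<Turnstile> reduct (slice i I) H \<longrightarrow>
        slice (Suc i) J \<Turnstile> reduct (slice (Suc i) I) (Imp G F)) \<and>
     (\<forall>c\<in>regular D. \<forall>v\<in>Dom D c. (c, v) \<in> slice 0 I \<longrightarrow> (c, v) \<in> slice 0 J) \<and>
     (\<forall>i<m. \<forall>c\<in>actions D. \<forall>v\<in>{TT, FF}. (c, v) \<in> slice i I \<longrightarrow> (c, v) \<in> slice i J) \<and>
     (\<forall>i<m. \<forall>(v, F, G)\<in>utility_laws D. slice (Suc i) J \<Turnstile> reduct (slice (Suc i) I) F \<longrightarrow>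
        slice i J \<Turnstile> reduct (slice i I) G \<longrightarrow> Utility v [Suc i, uid D (v, F, G)] \<in> J)"
proof -
  have imp: "J \<Turnstile> reduct I (Imp G F) \<longleftrightarrow> (J \<Turnstile> reduct I G \<longrightarrow> J \<Turnstile> reduct I F)"
    if "I \<Turnstile> Imp G F" for F G
    using that by (simp only: sat_reduct_Imp_iff simp_thms)
  have static: "J \<Turnstile> reduct I (rule_of (stamp_form i F) (stamp_form i G)) \<longleftrightarrow>
      slice i J \<Turnstile> reduct (slice i I) (Imp G F)" for i F G
    using sat_reduct_map_form[of J I "stamp_atom i" "Imp G F"] by simp
  \<comment> \<open>The condition on the earlier slice is split off from the implication on the
    later one. Truth of \<open>H\<close> in \<open>I\<close> comes back from its satisfied reduct
    and yields the outer test for \<open>Imp G F\<close>.\<close>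
  have dynamic: "J \<Turnstile> reduct I (rule_of (stamp_form j F) (And (stamp_form j G) (stamp_form i H)))
      \<longleftrightarrow> (slice i J \<Turnstile> reduct (slice i I) H \<longrightarrow> slice j J \<Turnstile> reduct (slice j I) (Imp G F))"
    if "I \<Turnstile> rule_of (stamp_form j F) (And (stamp_form j G) (stamp_form i H))" for i j F G H
    using that sat_reductD[of "slice i J" "slice i I" H]
    unfolding imp[OF that] sat_reduct_And_iff sat_reduct_map_form sat_reduct_Imp_iff
    by (auto simp: sat_map_form)
  have choice: "J \<Turnstile> reduct I (choice_rule a) \<longleftrightarrow> (a \<in> I \<longrightarrow> a \<in> J)" for a
    by auto
  have util: "J \<Turnstile> reduct I (rule_of (Atom a) (And (stamp_form j F) (stamp_form i G)))
      \<longleftrightarrow> (slice j J \<Turnstile> reduct (slice j I) F \<longrightarrow> slice i J \<Turnstile> reduct (slice i I) G \<longrightarrow> a \<in> J)"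
    if "I \<Turnstile> rule_of (Atom a) (And (stamp_form j F) (stamp_form i G))" for i j F G a
    using \<open>J \<subseteq> I\<close> unfolding imp[OF that] sat_reduct_And_iff sat_reduct_map_form by auto
  have constr: "J \<Turnstile> reduct I (Imp G Bot)" if "I \<Turnstile> Imp G Bot" for G
    using that sat_reductD[of J I G] by auto
  note sat = sat[unfolded ball_Tr_rules_iff]
  note sat_dynamic = sat[THEN conjunct2, THEN conjunct1]
  note sat_util = sat[THEN conjunct2, THEN conjunct2, THEN conjunct2, THEN conjunct2, THEN conjunct1]
  note sat_init = sat[THEN conjunct2, THEN conjunct2, THEN conjunct2, THEN conjunct2, THEN conjunct2]
  have "J \<Turnstile> reduct I (rule_of Bot (And (Neg (stamp_form 0 (Atom A))) (stamp_form 0 G)))"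
    if "(A, G) \<in> initial_laws D" for A G
    using sat_init that by (intro constr) blast
  moreover have "J \<Turnstile> reduct I
       (rule_of (stamp_form (Suc i) F) (And (stamp_form (Suc i) G) (stamp_form i H)))
      \<longleftrightarrow> (slice i J \<Turnstile> reduct (slice i I) H \<longrightarrow>
         slice (Suc i) J \<Turnstile> reduct (slice (Suc i) I) (Imp G F))"
    if "(F, G, H) \<in> dynamic_laws D" "i < m" for F G H i
    using sat_dynamic that by (intro dynamic) blast
  moreover have "J \<Turnstile> reduct I (rule_of (Atom (Utility v [Suc i, uid D (v, F, G)]))
        (And (stamp_form (Suc i) F) (stamp_form i G)))
      \<longleftrightarrow> (slice (Suc i) J \<Turnstile> reduct (slice (Suc i) I) F \<longrightarrow>
        slice i J \<Turnstile> reduct (slice i I) G \<longrightarrow> Utility v [Suc i, uid D (v, F, G)] \<in> J)"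
    if "(v, F, G) \<in> utility_laws D" "i < m" for F G v i
    using sat_util that by (intro util) blast
  ultimately show ?thesis
    unfolding ball_Tr_rules_iff static choice vimage_eq stamp_atom.simps
    by (simp only: Ball_def split_paired_All prod.case simp_thms cong: imp_cong)
qed

section \<open>State and step conditions on single slices\<close>

definition static_red ::
  "('c, 'v) action_desc \<Rightarrow> ('c, 'v) interp \<Rightarrow> ('c, 'v) interp \<Rightarrow> bool" where
  "static_red D J x \<longleftrightarrow> (\<forall>(F, G)\<in>static_laws D. J \<Turnstile> reduct x (Imp G F))"

text \<open>\<open>H\<close> is evaluated classically: once the earlier slice \<open>y\<close> is
  known to be unchanged, the reduct of \<open>H\<close> relative to \<open>y\<close> holds in
  \<open>y\<close> exactly when \<open>H\<close> does.\<close>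

definition dynamic_red ::
  "('c, 'v) action_desc \<Rightarrow> ('c, 'v) interp \<Rightarrow> ('c, 'v) interp \<Rightarrow> ('c, 'v) interp \<Rightarrow> bool" where
  "dynamic_red D y J x \<longleftrightarrow> (\<forall>(F, G, H)\<in>dynamic_laws D. y \<Turnstile> H \<longrightarrow> J \<Turnstile> reduct x (Imp G F))"

text \<open>Competitors keep the regular fluents, which reflects the choice rules at time 0; the
  statically determined ones have to be derived.\<close>

definition is_state :: "('c, 'v) action_desc \<Rightarrow> ('c, 'v) interp \<Rightarrow> bool" where
  "is_state D x \<longleftrightarrow> x \<in> assignments D (fluents D) \<and> static_red D x x \<and>
     (\<forall>J\<subseteq>x. x \<inter> atoms_over D (regular D) \<subseteq> J \<longrightarrow> static_red D J x \<longrightarrow> J = x)"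

text \<open>Here \<open>y\<close> is the interpretation of all constants except initpf constants before the step.\<close>

definition is_step ::
  "('c, 'v) action_desc \<Rightarrow> ('c, 'v) interp \<Rightarrow> ('c, 'v) interp \<Rightarrow> bool" where
  "is_step D y x \<longleftrightarrow> x \<in> assignments D (fluents D) \<and> static_red D x x \<and> dynamic_red D y x x \<and>
     (\<forall>J\<subseteq>x. static_red D J x \<longrightarrow> dynamic_red D y J x \<longrightarrow> J = x)"

definition init_ok :: "('c, 'v) action_desc \<Rightarrow> ('c, 'v) interp \<Rightarrow> bool" where
  "init_ok D x \<longleftrightarrow> (\<forall>(A, G)\<in>initial_laws D. x \<Turnstile> G \<longrightarrow> A \<in> x)"

text \<open>Utility atoms are no free data of a run: minimality forces exactly the heads whose
  bodies hold.\<close>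

definition run_model ::
  "('c, 'v) action_desc \<Rightarrow> nat \<Rightarrow> ('c, 'v) interp \<Rightarrow> (nat \<Rightarrow> ('c, 'v) interp)
     \<Rightarrow> (nat \<Rightarrow> ('c, 'v) interp) \<Rightarrow> (nat \<Rightarrow> ('c, 'v) interp) \<Rightarrow> ('c, 'v) tatom set" where
  "run_model D m q s e p =
     stamp_set 0 q \<union> (\<Union>i\<le>m. stamp_set i (s i)) \<union> (\<Union>i<m. stamp_set i (e i \<union> p i)) \<union>
     {Utility v [Suc i, uid D (v, F, G)] | i v F G. i < m \<and> (v, F, G) \<in> utility_laws D \<and>
        s (Suc i) \<Turnstile> F \<and> s i \<union> e i \<Turnstile> G}"

definition assigned ::
  "('c, 'v) action_desc \<Rightarrow> nat \<Rightarrow> ('c, 'v) interp \<Rightarrow> (nat \<Rightarrow> ('c, 'v) interp)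
     \<Rightarrow> (nat \<Rightarrow> ('c, 'v) interp) \<Rightarrow> (nat \<Rightarrow> ('c, 'v) interp) \<Rightarrow> bool" where
  "assigned D m q s e p \<longleftrightarrow> q \<in> assignments D (initpfs D) \<and>
     (\<forall>i\<le>m. s i \<in> assignments D (fluents D)) \<and>
     (\<forall>i<m. e i \<in> assignments D (actions D) \<and> p i \<in> assignments D (pfs D))"

lemma sat_restrict:
  assumes "form_over D C F" "x \<inter> atoms_over D C = y"
  shows "x \<Turnstile> F \<longleftrightarrow> y \<Turnstile> F"
  using sat_reduct_cong[of F x y x y] assms unfolding form_over_def by auto

lemma sat_reduct_restrict:
  assumes "form_over D C F" "x \<inter> atoms_over D C = y" "J \<inter> atoms_over D C = K"
  shows "J \<Turnstile> reduct x F \<longleftrightarrow> K \<Turnstile> reduct y F"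
  by (rule sat_reduct_cong) (use assms in \<open>unfold form_over_def, blast\<close>)

lemma form_over_Imp [simp]: "form_over D C (Imp F G) \<longleftrightarrow> form_over D C F \<and> form_over D C G"
  by (auto simp: form_over_def)

lemma atoms_over_Un: "atoms_over D (C \<union> C') = atoms_over D C \<union> atoms_over D C'"
  by (auto simp: atoms_over_def)

lemma assignments_Int_atoms_over:
  "x \<in> assignments D C \<Longrightarrow> C \<subseteq> C' \<Longrightarrow> x \<inter> atoms_over D C' = x"
  by (auto simp: assignments_def atoms_over_def)

lemma assignments_Int_atoms_over_disjoint:
  "x \<in> assignments D C \<Longrightarrow> C \<inter> C' = {} \<Longrightarrow> x \<inter> atoms_over D C' = {}"
  by (auto simp: assignments_def atoms_over_def)

section \<open>Consequences of well-formedness\<close>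

context
  fixes D :: "('c, 'v) action_desc"
  assumes wf: "wf_action_desc D"
begin

lemma wf_disjoint:
  "fluents D \<inter> actions D = {}" "fluents D \<inter> pfs D = {}" "fluents D \<inter> initpfs D = {}"
  "actions D \<inter> pfs D = {}" "actions D \<inter> initpfs D = {}" "pfs D \<inter> initpfs D = {}"
  using wf unfolding wf_action_desc_def by (simp_all only: simp_thms)

lemma wf_finite:
  "finite (fluents D)" "finite (actions D)" "finite (pfs D)" "finite (initpfs D)"
  "finite (static_laws D)" "finite (dynamic_laws D)" "finite (initial_laws D)"
  "finite (utility_laws D)"
  using wf unfolding wf_action_desc_def by (simp_all only: simp_thms finite_Un)

lemma finite_Dom:
  "c \<in> fluents D \<union> actions D \<union> pfs D \<union> initpfs D \<Longrightarrow> finite (Dom D c)"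
proof -
  have "\<forall>c \<in> fluents D \<union> actions D \<union> pfs D \<union> initpfs D. finite (Dom D c)"
    using wf unfolding wf_action_desc_def by (elim conjE) assumption
  then show "c \<in> fluents D \<union> actions D \<union> pfs D \<union> initpfs D \<Longrightarrow> finite (Dom D c)"
    by blast
qed

lemma Dom_actions: "c \<in> actions D \<Longrightarrow> Dom D c = {TT, FF}"
proof -
  have "\<forall>c \<in> actions D. Dom D c = {TT, FF}"
    using wf unfolding wf_action_desc_def by (elim conjE) assumption
  then show "c \<in> actions D \<Longrightarrow> Dom D c = {TT, FF}"
    by blast
qed

lemma prob_pos: "c \<in> pfs D \<union> initpfs D \<Longrightarrow> v \<in> Dom D c \<Longrightarrow> 0 < prob D c v"
proof -
  have "\<forall>c \<in> pfs D \<union> initpfs D. (\<forall>v \<in> Dom D c. 0 < prob D c v \<and> prob D c v < 1) \<and> (\<Sum>v\<in>Dom D c. prob D c v) = 1"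
    using wf unfolding wf_action_desc_def by (elim conjE) assumption
  then show "c \<in> pfs D \<union> initpfs D \<Longrightarrow> v \<in> Dom D c \<Longrightarrow> 0 < prob D c v"
    by blast
qed

lemma sum_prob: "c \<in> pfs D \<union> initpfs D \<Longrightarrow> (\<Sum>v\<in>Dom D c. prob D c v) = 1"
proof -
  have "\<forall>c \<in> pfs D \<union> initpfs D. (\<forall>v \<in> Dom D c. 0 < prob D c v \<and> prob D c v < 1) \<and> (\<Sum>v\<in>Dom D c. prob D c v) = 1"
    using wf unfolding wf_action_desc_def by (elim conjE) assumption
  then show "c \<in> pfs D \<union> initpfs D \<Longrightarrow> (\<Sum>v\<in>Dom D c. prob D c v) = 1"
    by blast
qed

lemma inj_uid: "inj_on (uid D) (utility_laws D)"
  using wf unfolding wf_action_desc_def by (elim conjE) assumption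

lemma static_laws_over:
  "(F, G) \<in> static_laws D \<Longrightarrow> form_over D (fluents D) F \<and> form_over D (fluents D) G"
proof -
  have "\<forall>(F, G) \<in> static_laws D. form_over D (fluents D) F \<and> form_over D (fluents D) G"
    using wf unfolding wf_action_desc_def by (elim conjE) assumption
  then show "(F, G) \<in> static_laws D \<Longrightarrow> form_over D (fluents D) F \<and> form_over D (fluents D) G"
    by blast
qed

lemma dynamic_laws_over:
  "(F, G, H) \<in> dynamic_laws D \<Longrightarrow> form_over D (regular D) F \<and> form_over D (fluents D) F \<and>
     form_over D (fluents D) G \<and> form_over D (fluents D \<union> actions D \<union> pfs D) H"
proof -
  have "\<forall>(F, G, H) \<in> dynamic_laws D. form_over D (regular D) F \<and> form_over D (fluents D) G \<and>
      form_over D (fluents D \<union> actions D \<union> pfs D) H"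
    using wf unfolding wf_action_desc_def by (elim conjE) assumption
  moreover assume "(F, G, H) \<in> dynamic_laws D"
  ultimately have "form_over D (regular D) F" "form_over D (fluents D) G"
    "form_over D (fluents D \<union> actions D \<union> pfs D) H"
    by blast+
  moreover from this have "form_over D (fluents D) F"
    unfolding form_over_def fluents_def atoms_over_Un by blast
  ultimately show ?thesis by blast
qed

lemma initial_laws_over:
  "(A, G) \<in> initial_laws D \<Longrightarrow> A \<in> atoms_over D (fluents D) \<and>
     form_over D (fluents D \<union> initpfs D) G"
proof -
  have "\<forall>(A, G) \<in> initial_laws D. A \<in> atoms_over D (fluents D) \<and> form_over D (fluents D \<union> initpfs D) G"
    using wf unfolding wf_action_desc_def by (elim conjE) assumption
  then show "(A, G) \<in> initial_laws D \<Longrightarrow> A \<in> atoms_over D (fluents D) \<and>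
     form_over D (fluents D \<union> initpfs D) G"
    by blast
qed

lemma utility_laws_over:
  "(v, F, G) \<in> utility_laws D \<Longrightarrow> form_over D (fluents D) F \<and>
     form_over D (fluents D \<union> actions D) G"
proof -
  have "\<forall>(v, F, G) \<in> utility_laws D. form_over D (fluents D) F \<and> form_over D (fluents D \<union> actions D) G"
    using wf unfolding wf_action_desc_def by (elim conjE) assumption
  then show "(v, F, G) \<in> utility_laws D \<Longrightarrow> form_over D (fluents D) F \<and>
     form_over D (fluents D \<union> actions D) G"
    by blast
qed

text \<open>Heads of dynamic laws mention only regular fluents, so a \<open>J\<close> that keeps the
  regular part of \<open>x\<close> satisfies every head that \<open>x\<close> satisfies. Such a
  \<open>J\<close> is therefore also a competitor for the step.\<close>

lemma is_step_imp_is_state: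
  assumes "is_step D y x"
  shows "is_state D x"
  unfolding is_state_def
proof (intro conjI allI impI)
  show "x \<in> assignments D (fluents D)" "static_red D x x"
    using assms unfolding is_step_def by blast+
  fix J assume J: "J \<subseteq> x" "x \<inter> atoms_over D (regular D) \<subseteq> J" "static_red D J x"
  have "dynamic_red D y J x"
    unfolding dynamic_red_def
  proof clarify
    fix F G H assume law: "(F, G, H) \<in> dynamic_laws D" and "y \<Turnstile> H"
    have "x \<Turnstile> reduct x (Imp G F)"
      using assms law \<open>y \<Turnstile> H\<close> unfolding is_step_def dynamic_red_def by blast
    then have sat: "x \<Turnstile> Imp G F"
      by (simp only: sat_reduct_self)
    have "J \<Turnstile> reduct x F \<longleftrightarrow> x \<Turnstile> reduct x F"
      by (rule sat_reduct_cong) (use dynamic_laws_over[OF law] J in \<open>unfold form_over_def, blast\<close>)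
    then show "J \<Turnstile> reduct x (Imp G F)"
      unfolding sat_reduct_Imp_iff using sat sat_reductD[of J x G] by simp
  qed
  then show "J = x"
    using assms J unfolding is_step_def by blast
qed

lemma SM_Tr_iff:
  "I \<in> SM (Tr D m) \<longleftrightarrow> (\<forall>R\<in>Tr_rules D m. I \<Turnstile> R) \<and>
     (\<forall>c\<in>Tr_consts D m. \<exists>!v. v \<in> tDom D c \<and> HasVal c v \<in> I) \<and>
     (\<forall>J\<subseteq>I. (\<forall>c r v. (c, r) \<in> Tr_decls D m \<longrightarrow> v \<in> tDom D c \<longrightarrow> HasVal c v \<in> I \<longrightarrow>
        HasVal c v \<in> J) \<longrightarrow> (\<forall>R\<in>Tr_rules D m. J \<Turnstile> reduct I R) \<longrightarrow> J = I)"
  unfolding Tr_eq_mvpp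
  by (rule SM_mvpp_iff) (use finite_Dom in \<open>auto simp: Tr_consts_def tDom_def\<close>)

section \<open>Stability of the model of a run\<close>

context
  fixes m :: nat and q :: "('c, 'v) interp" and s e p :: "nat \<Rightarrow> ('c, 'v) interp"
  assumes asg: "assigned D m q s e p"
begin

private abbreviation (input) "I \<equiv> run_model D m q s e p"

lemma slice_run_model:
  "slice i I = (if i = 0 then q else {}) \<union> (if i \<le> m then s i else {})
     \<union> (if i < m then e i \<union> p i else {})"
  by (auto simp: run_model_def)

lemma Utility_in_run_model_iff:
  "Utility v t \<in> I \<longleftrightarrow> (\<exists>i F G. t = [Suc i, uid D (v, F, G)] \<and> i < m \<and>
     (v, F, G) \<in> utility_laws D \<and> s (Suc i) \<Turnstile> F \<and> s i \<union> e i \<Turnstile> G)"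
  by (auto simp: run_model_def)

lemma assignedD:
  "q \<in> assignments D (initpfs D)"
  "i \<le> m \<Longrightarrow> s i \<in> assignments D (fluents D)"
  "i < m \<Longrightarrow> s i \<in> assignments D (fluents D)"
  "i < m \<Longrightarrow> e i \<in> assignments D (actions D)"
  "i < m \<Longrightarrow> p i \<in> assignments D (pfs D)"
  using asg unfolding assigned_def by auto

text \<open>Each kind of formula sees only some kinds of constants, and these restrictions isolate
  what it sees. Slice 0 also carries the initpf assignment, which only the last form
  retains.\<close>

lemma slice_run_model_Int:
  "i \<le> m \<Longrightarrow> slice i I \<inter> atoms_over D (fluents D) = s i"
  "i < m \<Longrightarrow> slice i I \<inter> atoms_over D (fluents D \<union> actions D) = s i \<union> e i"
  "i < m \<Longrightarrow> slice i I \<inter> atoms_over D (fluents D \<union> actions D \<union> pfs D) = s i \<union> e i \<union> p i"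
  "slice 0 I \<inter> atoms_over D (fluents D \<union> initpfs D) = s 0 \<union> q"
proof -
  show "slice i I \<inter> atoms_over D (fluents D) = s i" if "i \<le> m"
  proof -
    let ?A = "atoms_over D (fluents D)"
    have le: "i \<le> m" using that by simp
    have q: "q \<inter> ?A = {}"
      using assignedD(1)
      by (intro assignments_Int_atoms_over_disjoint) (use wf_disjoint in blast)+
    have s: "s i \<inter> ?A = s i"
      using assignedD(2)[of i] le
      by (intro assignments_Int_atoms_over) (use wf_disjoint in blast)+
    have e: "e i \<inter> ?A = {}" if "i < m"
      using assignedD(4)[of i] that
      by (intro assignments_Int_atoms_over_disjoint) (use wf_disjoint in blast)+
    have p: "p i \<inter> ?A = {}" if "i < m"
      using assignedD(5)[of i] that
      by (intro assignments_Int_atoms_over_disjoint) (use wf_disjoint in blast)+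
    show ?thesis
      using le that q s e p by (simp add: slice_run_model Int_Un_distrib2 Un_ac)
  qed
  show "slice i I \<inter> atoms_over D (fluents D \<union> actions D) = s i \<union> e i" if "i < m"
  proof -
    let ?A = "atoms_over D (fluents D \<union> actions D)"
    have le: "i \<le> m" using that by simp
    have q: "q \<inter> ?A = {}"
      using assignedD(1)
      by (intro assignments_Int_atoms_over_disjoint) (use wf_disjoint in blast)+
    have s: "s i \<inter> ?A = s i"
      using assignedD(2)[of i] le
      by (intro assignments_Int_atoms_over) (use wf_disjoint in blast)+
    have e: "e i \<inter> ?A = e i" if "i < m"
      using assignedD(4)[of i] that
      by (intro assignments_Int_atoms_over) (use wf_disjoint in blast)+
    have p: "p i \<inter> ?A = {}" if "i < m"
      using assignedD(5)[of i] that
      by (intro assignments_Int_atoms_over_disjoint) (use wf_disjoint in blast)+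
    show ?thesis
      using le that q s e p by (simp add: slice_run_model Int_Un_distrib2 Un_ac)
  qed
  show "slice i I \<inter> atoms_over D (fluents D \<union> actions D \<union> pfs D) = s i \<union> e i \<union> p i" if "i < m"
  proof -
    let ?A = "atoms_over D (fluents D \<union> actions D \<union> pfs D)"
    have le: "i \<le> m" using that by simp
    have q: "q \<inter> ?A = {}"
      using assignedD(1)
      by (intro assignments_Int_atoms_over_disjoint) (use wf_disjoint in blast)+
    have s: "s i \<inter> ?A = s i"
      using assignedD(2)[of i] le
      by (intro assignments_Int_atoms_over) (use wf_disjoint in blast)+
    have e: "e i \<inter> ?A = e i" if "i < m"
      using assignedD(4)[of i] that
      by (intro assignments_Int_atoms_over) (use wf_disjoint in blast)+
    have p: "p i \<inter> ?A = p i" if "i < m"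
      using assignedD(5)[of i] that
      by (intro assignments_Int_atoms_over) (use wf_disjoint in blast)+
    show ?thesis
      using le that q s e p by (simp add: slice_run_model Int_Un_distrib2 Un_ac)
  qed
  show "slice 0 I \<inter> atoms_over D (fluents D \<union> initpfs D) = s 0 \<union> q"
  proof -
    let ?A = "atoms_over D (fluents D \<union> initpfs D)"
    have le: "0 \<le> m" by simp
    have q: "q \<inter> ?A = q"
      using assignedD(1)
      by (intro assignments_Int_atoms_over) (use wf_disjoint in blast)+
    have s: "s 0 \<inter> ?A = s 0"
      using assignedD(2)[of 0] le
      by (intro assignments_Int_atoms_over) (use wf_disjoint in blast)+
    have e: "e 0 \<inter> ?A = {}" if "0 < m"
      using assignedD(4)[of 0] that
      by (intro assignments_Int_atoms_over_disjoint) (use wf_disjoint in blast)+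
    have p: "p 0 \<inter> ?A = {}" if "0 < m"
      using assignedD(5)[of 0] that
      by (intro assignments_Int_atoms_over_disjoint) (use wf_disjoint in blast)+
    show ?thesis
      using le q s e p by (simp add: slice_run_model Int_Un_distrib2 Un_ac)
  qed
qed

private abbreviation (input) "FL \<equiv> atoms_over D (fluents D)"
private abbreviation (input) "FA \<equiv> atoms_over D (fluents D \<union> actions D)"
private abbreviation (input) "FAP \<equiv> atoms_over D (fluents D \<union> actions D \<union> pfs D)"

text \<open>Utility rules leave no condition behind because \<open>run_model\<close> contains their
  heads whenever the bodies hold.\<close>

lemma sat_Tr_rules_run_model_iff:
  "(\<forall>R\<in>Tr_rules D m. I \<Turnstile> R) \<longleftrightarrow>
     (\<forall>i\<le>m. static_red D (s i) (s i)) \<and>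
     (\<forall>i<m. dynamic_red D (s i \<union> e i \<union> p i) (s (Suc i)) (s (Suc i))) \<and>
     init_ok D (s 0 \<union> q)"
proof -
  note Int = slice_run_model_Int
  have static: "slice i I \<Turnstile> Imp G F \<longleftrightarrow> s i \<Turnstile> reduct (s i) (Imp G F)"
    if "i \<le> m" "(F, G) \<in> static_laws D" for i F G
    using sat_restrict[OF _ Int(1)[OF that(1)], of "Imp G F"] static_laws_over[OF that(2)]
    by (simp only: form_over_Imp sat_reduct_self)
  have dynamic: "(slice i I \<Turnstile> H \<longrightarrow> slice (Suc i) I \<Turnstile> Imp G F) \<longleftrightarrow>
      (s i \<union> e i \<union> p i \<Turnstile> H \<longrightarrow> s (Suc i) \<Turnstile> reduct (s (Suc i)) (Imp G F))"
    if "i < m" "(F, G, H) \<in> dynamic_laws D" for i F G H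
    using sat_restrict[OF _ Int(1)[of "Suc i"], of "Imp G F"] sat_restrict[OF _ Int(3)[OF that(1)], of H]
      dynamic_laws_over[OF that(2)] Suc_leI[OF that(1)]
    by (simp only: form_over_Imp sat_reduct_self)
  have util: "Utility v [Suc i, uid D (v, F, G)] \<in> I"
    if "i < m" "(v, F, G) \<in> utility_laws D" "slice (Suc i) I \<Turnstile> F" "slice i I \<Turnstile> G" for i v F G
    unfolding Utility_in_run_model_iff
    using sat_restrict[OF _ Int(1)[of "Suc i"], of F] sat_restrict[OF _ Int(2)[OF that(1)], of G]
      utility_laws_over[OF that(2)] that Suc_leI[OF that(1)] by blast
  have init: "(slice 0 I \<Turnstile> G \<longrightarrow> A \<in> slice 0 I) \<longleftrightarrow> (s 0 \<union> q \<Turnstile> G \<longrightarrow> A \<in> s 0 \<union> q)"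
    if "(A, G) \<in> initial_laws D" for A G
  proof -
    have "A \<in> slice 0 I \<longleftrightarrow> A \<in> s 0 \<union> q"
      using initial_laws_over[OF that] Int(4) unfolding atoms_over_Un by blast
    then show ?thesis
      using sat_restrict[OF _ Int(4), of G] initial_laws_over[OF that] by simp
  qed
  show ?thesis
    unfolding sat_Tr_rules_iff static_red_def dynamic_red_def init_ok_def
    using static dynamic util init
    by (simp only: Ball_def split_paired_All prod.case simp_thms cong: imp_cong) 
qed

text \<open>Every reduct is cut down to the vocabulary of its law. \<open>J\<close> may differ from
  the model in all slices at once, so \<open>H\<close> is still evaluated in the slice of
  \<open>J\<close>; replacing that slice by the original one is left to the induction over
  time.\<close>

lemma reduct_Tr_rules_run_model_iff:
  assumes "J \<subseteq> I" "\<forall>R\<in>Tr_rules D m. I \<Turnstile> R"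
  shows "(\<forall>R\<in>Tr_rules D m. J \<Turnstile> reduct I R) \<longleftrightarrow>
     (\<forall>i\<le>m. static_red D (slice i J \<inter> FL) (s i)) \<and>
     (\<forall>i<m. \<forall>(F, G, H)\<in>dynamic_laws D.
        slice i J \<inter> FAP \<Turnstile> reduct (s i \<union> e i \<union> p i) H \<longrightarrow>
        slice (Suc i) J \<inter> FL \<Turnstile> reduct (s (Suc i)) (Imp G F)) \<and>
     s 0 \<inter> atoms_over D (regular D) \<subseteq> slice 0 J \<and>
     (\<forall>i<m. e i \<subseteq> slice i J) \<and>
     (\<forall>i<m. \<forall>(v, F, G)\<in>utility_laws D.
        slice (Suc i) J \<inter> FL \<Turnstile> reduct (s (Suc i)) F \<longrightarrow>
        slice i J \<inter> FA \<Turnstile> reduct (s i \<union> e i) G \<longrightarrow> Utility v [Suc i, uid D (v, F, G)] \<in> J)"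
proof -
  note Int = slice_run_model_Int
  have static: "slice i J \<Turnstile> reduct (slice i I) (Imp G F) \<longleftrightarrow>
      slice i J \<inter> FL \<Turnstile> reduct (s i) (Imp G F)"
    if "i \<le> m" "(F, G) \<in> static_laws D" for i F G
    using sat_reduct_restrict[OF _ Int(1)[OF that(1)] refl] static_laws_over[OF that(2)]
    by (simp only: form_over_Imp)
  have dynamic: "(slice i J \<Turnstile> reduct (slice i I) H \<longrightarrow>
        slice (Suc i) J \<Turnstile> reduct (slice (Suc i) I) (Imp G F)) \<longleftrightarrow>
      (slice i J \<inter> FAP \<Turnstile> reduct (s i \<union> e i \<union> p i) H \<longrightarrow>
        slice (Suc i) J \<inter> FL \<Turnstile> reduct (s (Suc i)) (Imp G F))"
    if "i < m" "(F, G, H) \<in> dynamic_laws D" for i F G H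
    using sat_reduct_restrict[OF _ Int(1)[of "Suc i"] refl, of "Imp G F"]
      sat_reduct_restrict[OF _ Int(3)[OF that(1)] refl, of H]
      dynamic_laws_over[OF that(2)] Suc_leI[OF that(1)]
    by (simp only: form_over_Imp)
  have util: "(slice (Suc i) J \<Turnstile> reduct (slice (Suc i) I) F \<longrightarrow>
        slice i J \<Turnstile> reduct (slice i I) G \<longrightarrow> U) \<longleftrightarrow>
      (slice (Suc i) J \<inter> FL \<Turnstile> reduct (s (Suc i)) F \<longrightarrow>
        slice i J \<inter> FA \<Turnstile> reduct (s i \<union> e i) G \<longrightarrow> U)"
    if "i < m" "(v, F, G) \<in> utility_laws D" for i v F G U
    using sat_reduct_restrict[OF _ Int(1)[of "Suc i"] refl, of F]
      sat_reduct_restrict[OF _ Int(2)[OF that(1)] refl, of G]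
      utility_laws_over[OF that(2)] Suc_leI[OF that(1)]
    by simp
  have reg: "(\<forall>c\<in>regular D. \<forall>v\<in>Dom D c. (c, v) \<in> slice 0 I \<longrightarrow> (c, v) \<in> slice 0 J) \<longleftrightarrow>
      s 0 \<inter> atoms_over D (regular D) \<subseteq> slice 0 J"
  proof -
    have "atoms_over D (regular D) \<subseteq> FL"
      by (auto simp: atoms_over_def fluents_def)
    then have "s 0 \<inter> atoms_over D (regular D) = slice 0 I \<inter> atoms_over D (regular D)"
      using Int(1)[of 0] by blast
    then show ?thesis
      unfolding atoms_over_def by blast
  qed
  have act: "(\<forall>c\<in>actions D. \<forall>v\<in>{TT, FF}. (c, v) \<in> slice i I \<longrightarrow> (c, v) \<in> slice i J) \<longleftrightarrow>
      e i \<subseteq> slice i J" if "i < m" for i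
  proof -
    let ?A = "atoms_over D (actions D)"
    have "s i \<inter> ?A = {}"
      using assignedD(3)[OF that] wf_disjoint(1) by (rule assignments_Int_atoms_over_disjoint)
    moreover have "e i \<inter> ?A = e i"
      using assignedD(4)[OF that] order_refl by (rule assignments_Int_atoms_over)
    ultimately have "e i = slice i I \<inter> ?A"
      using Int(2)[OF that] unfolding atoms_over_Un by blast
    moreover have "?A = actions D \<times> {TT, FF}"
      using Dom_actions unfolding atoms_over_def by auto
    ultimately have e: "e i = slice i I \<inter> actions D \<times> {TT, FF}"
      by simp
    show ?thesis
      unfolding e subset_iff split_paired_All by auto
  qed
  show ?thesis
    unfolding reduct_Tr_rules_iff[OF assms] static_red_def reg
    using static dynamic util act
    by (simp only: Ball_def[of "static_laws D"] Ball_def[of "dynamic_laws D"]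
        Ball_def[of "utility_laws D"] split_paired_All prod.case simp_thms cong: imp_cong)
qed

lemma unique_value_run_model:
  assumes "c \<in> Tr_consts D m"
  shows "\<exists>!v. v \<in> tDom D c \<and> HasVal c v \<in> I"
proof -
  obtain i k where c: "c = (i, k)" by (cases c)
  have uniq: "\<exists>!v. v \<in> Dom D k \<and> (k, v) \<in> slice i I"
    if "x \<in> assignments D C" "k \<in> C" "slice i I \<inter> atoms_over D C = x" for x C
  proof -
    have "v \<in> Dom D k \<and> (k, v) \<in> slice i I \<longleftrightarrow> (k, v) \<in> x" for v
      using that(2,3) unfolding atoms_over_def by blast
    then show ?thesis
      using that(1,2) unfolding assignments_def by auto
  qed
  have Un: "x \<union> y \<in> assignments D (C \<union> C')"
    if "x \<in> assignments D C" "y \<in> assignments D C'" "C \<inter> C' = {}" for x y C C'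
    using that unfolding assignments_def atoms_over_def by blast
  have "\<exists>!v. v \<in> Dom D k \<and> (k, v) \<in> slice i I"
  proof -
    consider "i \<le> m" "k \<in> fluents D" | "i < m" "k \<in> actions D \<union> pfs D" | "i = 0" "k \<in> initpfs D"
      using assms unfolding c Tr_consts_def by auto
    then show ?thesis
    proof cases
      case 1
      then show ?thesis
        using uniq[OF assignedD(2) _ slice_run_model_Int(1)] by blast
    next
      case 2
      have "s i \<union> e i \<union> p i \<in> assignments D (fluents D \<union> actions D \<union> pfs D)"
        using 2(1) wf_disjoint by (intro Un assignedD) auto
      then show ?thesis
        using uniq[OF _ _ slice_run_model_Int(3)] 2 by blast
    next
      case 3
      have "s 0 \<union> q \<in> assignments D (fluents D \<union> initpfs D)"
        using wf_disjoint by (intro Un assignedD) auto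
      then show ?thesis
        using uniq[OF _ _] slice_run_model_Int(4) 3 by blast
    qed
  qed
  then show ?thesis
    unfolding c tDom_def by simp
qed

text \<open>Uniqueness of values is automatic for assigned data, and the declarations amount to the
  demand that a competitor keep \<open>q\<close> and every \<open>p i\<close>.\<close>

lemma run_model_in_SM_Tr_iff_minimal:
  "I \<in> SM (Tr D m) \<longleftrightarrow> (\<forall>R\<in>Tr_rules D m. I \<Turnstile> R) \<and>
     (\<forall>J\<subseteq>I. q \<subseteq> slice 0 J \<longrightarrow> (\<forall>i<m. p i \<subseteq> slice i J) \<longrightarrow>
        (\<forall>R\<in>Tr_rules D m. J \<Turnstile> reduct I R) \<longrightarrow> J = I)"
proof -
  have facts: "(\<forall>c r v. (c, r) \<in> Tr_decls D m \<longrightarrow> v \<in> tDom D c \<longrightarrow> HasVal c v \<in> I \<longrightarrow> HasVal c v \<in> J)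
      \<longleftrightarrow> q \<subseteq> slice 0 J \<and> (\<forall>i<m. p i \<subseteq> slice i J)" (is "?L \<longleftrightarrow> ?R") for J
  proof
    assume L: ?L
    have "q \<subseteq> slice 0 J"
    proof
      fix a assume "a \<in> q"
      obtain c v where a: "a = (c, v)" by (cases a)
      have "c \<in> initpfs D" "v \<in> Dom D c"
        using \<open>a \<in> q\<close> assignedD(1) unfolding a assignments_def atoms_over_def by auto
      moreover have "HasVal (0, c) v \<in> I"
        using \<open>a \<in> q\<close> unfolding a run_model_def by auto
      ultimately have "HasVal (0, c) v \<in> J"
        using L[rule_format, of "(0, c)" "prob D c" v] unfolding Tr_decls_def tDom_def by auto
      then show "a \<in> slice 0 J" unfolding a by simp
    qed
    moreover have "p i \<subseteq> slice i J" if "i < m" for i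
    proof
      fix a assume "a \<in> p i"
      obtain c v where a: "a = (c, v)" by (cases a)
      have "c \<in> pfs D" "v \<in> Dom D c"
        using \<open>a \<in> p i\<close> assignedD(5)[OF that] unfolding a assignments_def atoms_over_def by auto
      moreover have "HasVal (i, c) v \<in> I"
        using \<open>a \<in> p i\<close> that unfolding a run_model_def by auto
      ultimately have "HasVal (i, c) v \<in> J"
        using L[rule_format, of "(i, c)" "prob D c" v] that unfolding Tr_decls_def tDom_def by auto
      then show "a \<in> slice i J" unfolding a by simp
    qed
    ultimately show ?R by blast
  next
    assume R: ?R
    show ?L
    proof (intro allI impI)
      fix c r v
      assume decl: "(c, r) \<in> Tr_decls D m" and v: "v \<in> tDom D c" and I: "HasVal c v \<in> I"
      from decl consider i k where "c = (i, k)" "i < m" "k \<in> pfs D"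
        | k where "c = (0, k)" "k \<in> initpfs D"
        unfolding Tr_decls_def by auto
      then show "HasVal c v \<in> J"
      proof cases
        case 1
        have "(k, v) \<in> slice i I \<inter> FAP"
          using 1 v I unfolding atoms_over_def tDom_def by simp
        then have "(k, v) \<in> s i \<union> e i \<union> p i"
          unfolding slice_run_model_Int(3)[OF 1(2)] .
        moreover have "(k, v) \<notin> s i" "(k, v) \<notin> e i"
          using assignedD(3,4)[OF 1(2)] wf_disjoint 1(3)
          unfolding assignments_def atoms_over_def by blast+
        ultimately have "(k, v) \<in> slice i J"
          using R 1 by blast
        then show ?thesis using 1 by simp
      next
        case 2
        have "(k, v) \<in> slice 0 I \<inter> atoms_over D (fluents D \<union> initpfs D)"
          using 2 v I unfolding atoms_over_def tDom_def by simp
        then have "(k, v) \<in> s 0 \<union> q"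
          unfolding slice_run_model_Int(4) .
        moreover have "(k, v) \<notin> s 0"
          using assignedD(2)[of 0] wf_disjoint 2(2)
          unfolding assignments_def atoms_over_def by blast
        ultimately have "(k, v) \<in> slice 0 J"
          using R by blast
        then show ?thesis using 2 by simp
      qed
    qed
  qed
  have uec: "(\<forall>c\<in>Tr_consts D m. \<exists>!v. v \<in> tDom D c \<and> HasVal c v \<in> I) \<longleftrightarrow> True"
    using unique_value_run_model by blast
  show ?thesis
    unfolding SM_Tr_iff facts uec imp_conjL simp_thms ..
qed

theorem run_model_in_SM_Tr_iff:
  "I \<in> SM (Tr D m) \<longleftrightarrow> is_state D (s 0) \<and> init_ok D (s 0 \<union> q) \<and>
     (\<forall>i<m. is_step D (s i \<union> e i \<union> p i) (s (Suc i)))" (is "?L \<longleftrightarrow> ?R")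
proof
  assume R: ?R
  have static: "static_red D (s i) (s i)" if "i \<le> m" for i
    using R that by (cases i) (auto simp: is_state_def is_step_def)
  have sat: "\<forall>R\<in>Tr_rules D m. I \<Turnstile> R"
    unfolding sat_Tr_rules_run_model_iff using static R by (auto simp: is_step_def)
  have "J = I" if J: "J \<subseteq> I" "q \<subseteq> slice 0 J" "\<forall>i<m. p i \<subseteq> slice i J"
    "\<forall>R\<in>Tr_rules D m. J \<Turnstile> reduct I R" for J
  proof -
    note red = J(4)[unfolded reduct_Tr_rules_run_model_iff[OF J(1) sat]]
    note red_static = red[THEN conjunct1]
      and red_dynamic = red[THEN conjunct2, THEN conjunct1]
      and red_reg = red[THEN conjunct2, THEN conjunct2, THEN conjunct1]
      and red_act = red[THEN conjunct2, THEN conjunct2, THEN conjunct2, THEN conjunct1]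
      and red_util = red[THEN conjunct2, THEN conjunct2, THEN conjunct2, THEN conjunct2]
    have le: "slice i J \<inter> FL \<subseteq> s i" if "i \<le> m" for i
      using J(1) slice_run_model_Int(1)[OF that] by blast
    \<comment> \<open>Choice rules keep the actions and declarations the pf values, so agreement on
      fluents is agreement on everything that bodies of later laws can see.\<close>
    have FAP: "slice i J \<inter> FAP = s i \<union> e i \<union> p i" "slice i J \<inter> FA = s i \<union> e i"
      if "i < m" "slice i J \<inter> FL = s i" for i
    proof -
      have ge: "s i \<subseteq> slice i J" "e i \<subseteq> slice i J" "p i \<subseteq> slice i J"
        using that J(3) red_act by blast+
      show "slice i J \<inter> FAP = s i \<union> e i \<union> p i"
        using ge slice_run_model_Int(3)[OF that(1)] J(1) by blast
      show "slice i J \<inter> FA = s i \<union> e i"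
        using ge slice_run_model_Int(2)[OF that(1)] J(1) by blast
    qed
    have FL: "slice i J \<inter> FL = s i" if "i \<le> m" for i
      using that
    proof (induction i)
      case 0
      have "is_state D (s 0)" using R by blast
      moreover have "s 0 \<inter> atoms_over D (regular D) \<subseteq> slice 0 J \<inter> FL"
        using red_reg by (auto simp: atoms_over_def fluents_def)
      ultimately show ?case
        using red_static le[of 0] unfolding is_state_def by blast
    next
      case (Suc i)
      then have "i < m" "slice i J \<inter> FL = s i" by auto
      note FAP = FAP(1)[OF this]
      have "dynamic_red D (s i \<union> e i \<union> p i) (slice (Suc i) J \<inter> FL) (s (Suc i))"
        unfolding dynamic_red_def
      proof clarify
        fix F G H assume law: "(F, G, H) \<in> dynamic_laws D" and "s i \<union> e i \<union> p i \<Turnstile> H"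
        then have "slice i J \<inter> FAP \<Turnstile> reduct (s i \<union> e i \<union> p i) H"
          unfolding FAP by (simp only: sat_reduct_self)
        then show "slice (Suc i) J \<inter> FL \<Turnstile> reduct (s (Suc i)) (Imp G F)"
          using red_dynamic law \<open>i < m\<close> by blast
      qed
      moreover have "is_step D (s i \<union> e i \<union> p i) (s (Suc i))"
        using R \<open>i < m\<close> by blast
      moreover have "static_red D (slice (Suc i) J \<inter> FL) (s (Suc i))"
        using red_static Suc.prems by blast
      ultimately show ?case
        using le[OF Suc.prems] unfolding is_step_def by blast
    qed
    \<comment> \<open>Utility atoms are recovered last: the reducts of their bodies are known to
      hold only after both neighbouring slices are known to agree.\<close>
    have "I \<subseteq> J"
    proof
      fix a assume a: "a \<in> I"
      show "a \<in> J"
      proof (cases a)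
        case (HasVal k v)
        obtain i c where k: "k = (i, c)" by (cases k)
        have "s j \<subseteq> slice j J" if "j \<le> m" for j
          using FL[OF that] by blast
        then have "slice i I \<subseteq> slice i J"
          using J(2,3) red_act unfolding slice_run_model by simp
        moreover have "(c, v) \<in> slice i I" using a HasVal k by simp
        ultimately have "(c, v) \<in> slice i J" by blast
        then show ?thesis using HasVal k by simp
      next
        case (Utility v t)
        then obtain i F G where t: "t = [Suc i, uid D (v, F, G)]" "i < m" "(v, F, G) \<in> utility_laws D"
            and sat: "s (Suc i) \<Turnstile> F" "s i \<union> e i \<Turnstile> G"
          using a Utility_in_run_model_iff[of v t] by blast
        have "slice (Suc i) J \<inter> FL = s (Suc i)" "slice i J \<inter> FA = s i \<union> e i"
          using FL t(2) FAP(2) by auto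
        then have "slice (Suc i) J \<inter> FL \<Turnstile> reduct (s (Suc i)) F" "slice i J \<inter> FA \<Turnstile> reduct (s i \<union> e i) G"
          using sat by simp_all
        then have "Utility v [Suc i, uid D (v, F, G)] \<in> J"
          using red_util t(2,3) by blast
        then show ?thesis unfolding Utility t(1) .
      qed
    qed
    with J(1) show "J = I" by blast
  qed
  with sat show ?L
    unfolding run_model_in_SM_Tr_iff_minimal by blast
next
  assume L: ?L
  then have sat: "\<forall>R\<in>Tr_rules D m. I \<Turnstile> R"
    and minimal: "\<And>J. J \<subseteq> I \<Longrightarrow> q \<subseteq> slice 0 J \<Longrightarrow> \<forall>i<m. p i \<subseteq> slice i J \<Longrightarrow>
        \<forall>R\<in>Tr_rules D m. J \<Turnstile> reduct I R \<Longrightarrow> J = I"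
    unfolding run_model_in_SM_Tr_iff_minimal by blast+
  note sat' = sat[unfolded sat_Tr_rules_run_model_iff]
  \<comment> \<open>Both remaining claims are instances: \<open>k = 0\<close> gives the state, where
    the regular part must survive the choice rules, and \<open>k = Suc i\<close> gives the step,
    where the dynamic laws apply.\<close>
  have local: "J = s k" if k: "k \<le> m" and J: "J \<subseteq> s k" "static_red D J (s k)"
    and reg: "k = 0 \<Longrightarrow> s 0 \<inter> atoms_over D (regular D) \<subseteq> J"
    and dyn: "\<And>i. k = Suc i \<Longrightarrow> dynamic_red D (s i \<union> e i \<union> p i) J (s k)" for k J
  proof -
    \<comment> \<open>Only the fluents of slice \<open>k\<close> that \<open>J\<close> drops are
      removed; all utility atoms stay.\<close>
    define I' where "I' = I - stamp_set k (s k - J)"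
    have slice: "slice i I' = (if i = k then slice i I - (s k - J) else slice i I)" for i
      unfolding I'_def by auto
    have sub: "I' \<subseteq> I" unfolding I'_def by blast
    have sFL: "s k \<subseteq> FL"
      using assignedD(2)[OF k] unfolding assignments_def by blast
    have disj: "x \<inter> s k = {}" if "x \<in> assignments D C" "fluents D \<inter> C = {}" for x C
      using that assignedD(2)[OF k] unfolding assignments_def atoms_over_def by blast
    have FL: "slice i I' \<inter> FL = (if i = k then J else s i)" if "i \<le> m" for i
      using slice_run_model_Int(1)[OF that] J(1) sFL unfolding slice by auto
    have q: "q \<subseteq> slice 0 I'"
    proof -
      have "q \<inter> s k = {}"
        using disj[OF assignedD(1)] wf_disjoint by blast
      moreover have "q \<subseteq> slice 0 I" unfolding slice_run_model by auto
      ultimately show ?thesis unfolding slice by auto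
    qed
    have e: "e i \<subseteq> slice i I'" and p: "p i \<subseteq> slice i I'" if "i < m" for i
    proof -
      have "e i \<inter> s k = {}" "p i \<inter> s k = {}"
        using disj[OF assignedD(4)[OF that]] disj[OF assignedD(5)[OF that]] wf_disjoint by blast+
      moreover have "e i \<subseteq> slice i I" "p i \<subseteq> slice i I"
        unfolding slice_run_model using that by auto
      ultimately show "e i \<subseteq> slice i I'" "p i \<subseteq> slice i I'"
        unfolding slice by auto
    qed
    have "\<forall>R\<in>Tr_rules D m. I' \<Turnstile> reduct I R"
      unfolding reduct_Tr_rules_run_model_iff[OF sub sat]
    proof (intro conjI allI impI; clarify?)
      show "static_red D (slice i I' \<inter> FL) (s i)" if "i \<le> m" for i
        using that J(2) sat' FL by auto
    next
      fix i F G H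
      assume i: "i < m" and law: "(F, G, H) \<in> dynamic_laws D"
        and H: "slice i I' \<inter> FAP \<Turnstile> reduct (s i \<union> e i \<union> p i) H"
      \<comment> \<open>\<open>H\<close> may look at the shrunken slice, but satisfaction of its
        reduct implies truth in the original one, which is what \<open>dynamic_red\<close> asks
        for.\<close>
      have "s i \<union> e i \<union> p i \<Turnstile> H"
        using H by (rule sat_reductD)
      moreover have "dynamic_red D (s i \<union> e i \<union> p i) (slice (Suc i) I' \<inter> FL) (s (Suc i))"
        using dyn[of i] sat' i FL[of "Suc i"] by (cases "Suc i = k") auto
      ultimately show "slice (Suc i) I' \<inter> FL \<Turnstile> reduct (s (Suc i)) (Imp G F)"
        using law unfolding dynamic_red_def by blast
    next
      fix c v assume "(c, v) \<in> s 0" "(c, v) \<in> atoms_over D (regular D)"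
      then have "(c, v) \<in> slice 0 I' \<inter> FL"
        using FL[of 0] reg by auto
      then show "(c, v) \<in> slice 0 I'" by blast
    next
      fix i c v assume "i < m" "(c, v) \<in> e i"
      then show "(c, v) \<in> slice i I'" using e by blast
    next
      fix i v F G
      assume i: "i < m" and law: "(v, F, G) \<in> utility_laws D"
        and F: "slice (Suc i) I' \<inter> FL \<Turnstile> reduct (s (Suc i)) F"
        and G: "slice i I' \<inter> FA \<Turnstile> reduct (s i \<union> e i) G"
      have "Utility v [Suc i, uid D (v, F, G)] \<in> I"
        unfolding Utility_in_run_model_iff using i law sat_reductD[OF F] sat_reductD[OF G] by blast
      then show "Utility v [Suc i, uid D (v, F, G)] \<in> I'"
        unfolding I'_def by simp
    qed
    then have "I' = I"
      using minimal[OF sub] q p by blast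
    then show "J = s k"
      using FL[OF k] slice_run_model_Int(1)[OF k] by simp
  qed
  have "is_state D (s 0)"
    unfolding is_state_def using assignedD(2)[of 0] sat' local[of 0] by auto
  moreover have "is_step D (s i \<union> e i \<union> p i) (s (Suc i))" if "i < m" for i
    unfolding is_step_def using assignedD(2)[of "Suc i"] sat' local[of "Suc i"] that by auto
  ultimately show ?R
    using sat' by blast
qed

end

end

text \<open>The run cut out of \<open>I\<close> has a model \<open>J\<close> below \<open>I\<close>
  that agrees with \<open>I\<close> wherever the laws look, so \<open>J\<close> satisfies the
  reduct. Minimality then excludes stray atoms in \<open>I\<close>: values outside the domains,
  foreign time points, utility atoms without a true body.\<close>

lemma ex_run_of_SM_Tr:
  assumes wf: "wf_action_desc D" and I: "I \<in> SM (Tr D m)"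
  shows "\<exists>q s e p. assigned D m q s e p \<and> s \<in> extensional {0..m} \<and> e \<in> extensional {..<m} \<and>
     p \<in> extensional {..<m} \<and> I = run_model D m q s e p"
proof -
  define q where "q = slice 0 I \<inter> atoms_over D (initpfs D)"
  define s where "s = (\<lambda>i\<in>{0..m}. slice i I \<inter> atoms_over D (fluents D))"
  define e where "e = (\<lambda>i\<in>{..<m}. slice i I \<inter> atoms_over D (actions D))"
  define p where "p = (\<lambda>i\<in>{..<m}. slice i I \<inter> atoms_over D (pfs D))"
  have sat: "\<forall>R\<in>Tr_rules D m. I \<Turnstile> R"
    and uec: "\<And>c. c \<in> Tr_consts D m \<Longrightarrow> \<exists>!v. v \<in> tDom D c \<and> HasVal c v \<in> I"
    and minimal: "\<And>J. J \<subseteq> I \<Longrightarrow> (\<And>c r v. (c, r) \<in> Tr_decls D m \<Longrightarrow> v \<in> tDom D c \<Longrightarrow>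
        HasVal c v \<in> I \<Longrightarrow> HasVal c v \<in> J) \<Longrightarrow> (\<forall>R\<in>Tr_rules D m. J \<Turnstile> reduct I R) \<Longrightarrow> J = I"
    using I unfolding SM_Tr_iff[OF wf] by blast+
  have asg_slice: "slice i I \<inter> atoms_over D C \<in> assignments D C"
    if "\<And>c. c \<in> C \<Longrightarrow> (i, c) \<in> Tr_consts D m" for i C
    using uec[OF that] unfolding assignments_def atoms_over_def tDom_def by (simp add: conj_commute)
  have asg: "assigned D m q s e p"
    unfolding assigned_def q_def s_def e_def p_def
    by (auto intro!: asg_slice simp: Tr_consts_def)
  note Int = slice_run_model_Int[OF wf asg]
  define J where "J = run_model D m q s e p"
  have sl: "slice i I \<inter> atoms_over D (fluents D) = s i" if "i \<le> m" for i
    using that unfolding s_def by simp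
  have slA: "slice i I \<inter> atoms_over D (fluents D \<union> actions D) = s i \<union> e i" if "i < m" for i
    using that unfolding s_def e_def atoms_over_Un by auto
  have slP: "slice i I \<inter> atoms_over D (fluents D \<union> actions D \<union> pfs D) = s i \<union> e i \<union> p i"
    if "i < m" for i
    using that unfolding s_def e_def p_def atoms_over_Un by auto
  note sat' = sat[unfolded sat_Tr_rules_iff]
  have util: "Utility v [Suc i, uid D (v, F, G)] \<in> I"
    if "i < m" "(v, F, G) \<in> utility_laws D" "s (Suc i) \<Turnstile> F" "s i \<union> e i \<Turnstile> G" for i v F G
  proof -
    have "slice (Suc i) I \<Turnstile> F"
      using that utility_laws_over[OF wf that(2)] sat_restrict[OF _ sl[of "Suc i"], of F] by simp
    moreover have "slice i I \<Turnstile> G"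
      using that utility_laws_over[OF wf that(2)] sat_restrict[OF _ slA[of i], of G] by simp
    ultimately show ?thesis
      using sat' that(1,2) by blast
  qed
  have sub: "J \<subseteq> I"
  proof -
    have "q \<subseteq> slice 0 I" "\<And>i. i \<le> m \<Longrightarrow> s i \<subseteq> slice i I"
      "\<And>i. i < m \<Longrightarrow> e i \<union> p i \<subseteq> slice i I"
      unfolding q_def s_def e_def p_def by auto
    then show ?thesis
      unfolding J_def run_model_def using util by (fastforce simp: image_subset_iff_subset_vimage)
  qed
  have act: "\<forall>i<m. \<forall>c\<in>actions D. \<forall>v\<in>{TT, FF}. (c, v) \<in> slice i I \<longrightarrow> (c, v) \<in> slice i J"
  proof (intro allI impI ballI)
    fix i c v assume i: "i < m" and "c \<in> actions D" "v \<in> {TT, FF}" "(c, v) \<in> slice i I"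
    then have "(c, v) \<in> slice i I \<inter> atoms_over D (fluents D \<union> actions D)"
      unfolding atoms_over_def using Dom_actions[OF wf] by auto
    then show "(c, v) \<in> slice i J"
      unfolding J_def slA[OF i] using Int(2)[OF i] by blast
  qed
  have red: "\<forall>R\<in>Tr_rules D m. J \<Turnstile> reduct I R"
    unfolding reduct_Tr_rules_iff[OF sub sat]
  proof (intro conjI act; intro allI impI ballI; clarify?)
    fix i F G assume i: "i \<le> m" and law: "(F, G) \<in> static_laws D"
    \<comment> \<open>\<open>J\<close> and \<open>I\<close> have the same fluents at time
      \<open>i\<close>, so the claim reduces to truth in \<open>I\<close> itself.\<close>
    have "slice i J \<Turnstile> reduct (slice i I) (Imp G F) \<longleftrightarrow> slice i I \<Turnstile> reduct (slice i I) (Imp G F)"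
      unfolding J_def using sat_reduct_restrict[OF _ sl[OF i] Int(1)[OF i]]
        sat_reduct_restrict[OF _ sl[OF i] sl[OF i]] static_laws_over[OF wf law]
      by (simp only: form_over_Imp)
    moreover have "slice i I \<Turnstile> Imp G F"
      using sat' i law by blast
    ultimately show "slice i J \<Turnstile> reduct (slice i I) (Imp G F)"
      by (simp only: sat_reduct_self)
  next
    fix i F G H assume i: "i < m" and law: "(F, G, H) \<in> dynamic_laws D"
      and H: "slice i J \<Turnstile> reduct (slice i I) H"
    from i have i': "Suc i \<le> m" by simp
    have "slice (Suc i) J \<Turnstile> reduct (slice (Suc i) I) (Imp G F) \<longleftrightarrow>
        slice (Suc i) I \<Turnstile> reduct (slice (Suc i) I) (Imp G F)"
      unfolding J_def using sat_reduct_restrict[OF _ sl[OF i'] Int(1)[OF i']]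
        sat_reduct_restrict[OF _ sl[OF i'] sl[OF i']] dynamic_laws_over[OF wf law]
      by (simp only: form_over_Imp)
    moreover have "slice (Suc i) I \<Turnstile> Imp G F"
      using sat' i law sat_reductD[OF H] by blast
    ultimately show "slice (Suc i) J \<Turnstile> reduct (slice (Suc i) I) (Imp G F)"
      by (simp only: sat_reduct_self)
  next
    fix c v assume "c \<in> regular D" "v \<in> Dom D c" "stamp_atom 0 (c, v) \<in> I"
    then have "(c, v) \<in> slice 0 I \<inter> atoms_over D (fluents D)"
      unfolding atoms_over_def fluents_def by blast
    then show "(c, v) \<in> slice 0 J"
      unfolding J_def sl[of 0, simplified] using Int(1)[of 0] by blast
  next
    fix i v F G assume i: "i < m" and law: "(v, F, G) \<in> utility_laws D"
      and F: "slice (Suc i) J \<Turnstile> reduct (slice (Suc i) I) F"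
      and G: "slice i J \<Turnstile> reduct (slice i I) G"
    have "s (Suc i) \<Turnstile> F"
      using sat_reductD[OF F] i utility_laws_over[OF wf law] sat_restrict[OF _ sl[of "Suc i"], of F]
      by simp
    moreover have "s i \<union> e i \<Turnstile> G"
      using sat_reductD[OF G] i utility_laws_over[OF wf law] sat_restrict[OF _ slA[of i], of G]
      by simp
    ultimately show "Utility v [Suc i, uid D (v, F, G)] \<in> J"
      unfolding J_def run_model_def using i law by blast
  qed
  have facts: "HasVal c v \<in> J"
    if decl: "(c, r) \<in> Tr_decls D m" and v: "v \<in> tDom D c" and I: "HasVal c v \<in> I" for c r v
  proof -
    from decl consider i k where "c = (i, k)" "i < m" "k \<in> pfs D"
      | k where "c = (0, k)" "k \<in> initpfs D"
      unfolding Tr_decls_def by auto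
    then show ?thesis
    proof cases
      case 1
      then have "(k, v) \<in> p i"
        using v I unfolding p_def tDom_def atoms_over_def by simp
      then show ?thesis
        unfolding J_def run_model_def using 1 by auto
    next
      case 2
      then have "(k, v) \<in> q"
        using v I unfolding q_def tDom_def atoms_over_def by simp
      then show ?thesis
        unfolding J_def run_model_def using 2 by auto
    qed
  qed
  have "I = J"
    using minimal[OF sub facts red] by simp
  moreover have "s \<in> extensional {0..m}" "e \<in> extensional {..<m}" "p \<in> extensional {..<m}"
    unfolding s_def e_def p_def by auto
  ultimately show ?thesis
    using asg unfolding J_def by blast
qed

text \<open>Extensional functions make a run recoverable from its model, as reindexing of sums
  requires. Asking all slices to be states loses nothing, by \<open>is_step_imp_is_state\<close>,
  and matches the path space of the MDP.\<close>

definition runs :: "('c, 'v) action_desc \<Rightarrow> nat \<Rightarrow>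
    ((('c, 'v) interp \<times> (nat \<Rightarrow> ('c, 'v) interp)) \<times>
     ((nat \<Rightarrow> ('c, 'v) interp) \<times> (nat \<Rightarrow> ('c, 'v) interp))) set" where
  "runs D m = {((q, s), (e, p)).
     q \<in> assignments D (initpfs D) \<and> s \<in> {0..m} \<rightarrow>\<^sub>E Collect (is_state D) \<and>
     e \<in> {..<m} \<rightarrow>\<^sub>E assignments D (actions D) \<and> p \<in> {..<m} \<rightarrow>\<^sub>E assignments D (pfs D) \<and>
     init_ok D (s 0 \<union> q) \<and> (\<forall>i<m. is_step D (s i \<union> e i \<union> p i) (s (Suc i)))}"

abbreviation model_of_run where
  "model_of_run D m \<equiv> (\<lambda>((q, s), (e, p)). run_model D m q s e p)"

lemma assigned_of_run:
  assumes "((q, s), (e, p)) \<in> runs D m"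
  shows "assigned D m q s e p"
  using assms unfolding runs_def assigned_def by (auto simp: is_state_def PiE_iff)

lemma SM_Tr_eq_runs:
  assumes wf: "wf_action_desc D"
  shows "SM (Tr D m) = model_of_run D m ` runs D m"
proof (intro equalityI subsetI)
  fix I assume I: "I \<in> SM (Tr D m)"
  obtain q s e p where asg: "assigned D m q s e p" and ext: "s \<in> extensional {0..m}"
      "e \<in> extensional {..<m}" "p \<in> extensional {..<m}" and eq: "I = run_model D m q s e p"
    using ex_run_of_SM_Tr[OF wf I] by blast
  have run: "is_state D (s 0)" "init_ok D (s 0 \<union> q)"
     "\<And>i. i < m \<Longrightarrow> is_step D (s i \<union> e i \<union> p i) (s (Suc i))"
    using I unfolding eq run_model_in_SM_Tr_iff[OF wf asg] by blast+
  have "is_state D (s i)" if "i \<le> m" for i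
    using that run(1) is_step_imp_is_state[OF wf run(3)] by (cases i) auto
  then have "((q, s), (e, p)) \<in> runs D m"
    using run asg ext unfolding runs_def assigned_def by (simp add: PiE_iff)
  then show "I \<in> model_of_run D m ` runs D m"
    unfolding eq by (intro image_eqI) auto
next
  fix I assume "I \<in> model_of_run D m ` runs D m"
  then obtain q s e p where run: "((q, s), (e, p)) \<in> runs D m" and eq: "I = run_model D m q s e p"
    by auto
  show "I \<in> SM (Tr D m)"
    using run unfolding eq run_model_in_SM_Tr_iff[OF wf assigned_of_run[OF run]] runs_def
    by (auto simp: PiE_iff)
qed

text \<open>The parts live over disjoint vocabularies, so known parts cancel from the restricted
  slices; extensionality settles the arguments beyond the horizon.\<close>

lemma inj_on_model_of_run:
  assumes wf: "wf_action_desc D"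
  shows "inj_on (model_of_run D m) (runs D m)"
proof (rule inj_onI, clarify)
  fix q s e p q' s' e' p'
  assume run: "((q, s), (e, p)) \<in> runs D m" and run': "((q', s'), (e', p')) \<in> runs D m"
    and eq: "run_model D m q s e p = run_model D m q' s' e' p'"
  note asg = assigned_of_run[OF run] and asg' = assigned_of_run[OF run']
  note Int = slice_run_model_Int[OF wf asg] and Int' = slice_run_model_Int[OF wf asg', folded eq]
  note D = assignedD[OF wf asg] and D' = assignedD[OF wf asg']
  have disj: "x = y" if "x \<in> assignments D C" "y \<in> assignments D C" "C \<inter> C' = {}"
    "z \<in> assignments D C'" "z \<union> x = z \<union> y" for x y z C C'
  proof -
    have "z \<inter> x = {}" "z \<inter> y = {}"
      using that(1-4) unfolding assignments_def atoms_over_def by blast+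
    with that(5) show ?thesis by blast
  qed
  have s: "s i = s' i" if "i \<le> m" for i
    using Int(1)[OF that] Int'(1)[OF that] by simp
  have e: "e i = e' i" if "i < m" for i
    using disj[OF D(4)[OF that] D'(4)[OF that] _ D(3)[OF that]] wf_disjoint(1)[OF wf]
      Int(2)[OF that] Int'(2)[OF that] s[of i] that by (auto simp: Int_commute)
  have p: "p i = p' i" if "i < m" for i
  proof -
    have "s i \<union> e i \<in> assignments D (fluents D \<union> actions D)"
      using D(3,4)[OF that] wf_disjoint(1)[OF wf] unfolding assignments_def atoms_over_def by blast
    then show ?thesis
      using disj[OF D(5)[OF that] D'(5)[OF that]] wf_disjoint[OF wf]
        Int(3)[OF that] Int'(3)[OF that] s[of i] e[of i] that
      by (metis Int_Un_distrib Int_commute Un_empty less_imp_le)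
  qed
  have q: "q = q'"
    using disj[OF D(1) D'(1) _ D(2)[of 0]] wf_disjoint(3)[OF wf] Int(4) Int'(4) s[of 0]
    by (auto simp: Int_commute)
  from run run' have ext: "s \<in> extensional {0..m}" "s' \<in> extensional {0..m}"
      "e \<in> extensional {..<m}" "e' \<in> extensional {..<m}"
      "p \<in> extensional {..<m}" "p' \<in> extensional {..<m}"
    unfolding runs_def PiE_def by blast+
  have "s = s'"
    by (rule extensionalityI[OF ext(1,2)]) (use s in simp)
  moreover have "e = e'"
    by (rule extensionalityI[OF ext(3,4)]) (use e in simp)
  moreover have "p = p'"
    by (rule extensionalityI[OF ext(5,6)]) (use p in simp)
  ultimately show "(q, s) = (q', s') \<and> (e, p) = (e', p')"
    using q by simp
qed

section \<open>Weights and utilities of runs\<close>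

definition assignment_prob :: "('c, 'v) action_desc \<Rightarrow> ('c, 'v) interp \<Rightarrow> real" where
  "assignment_prob D x = (\<Prod>(c, v)\<in>x. prob D c v)"

text \<open>Utility collected in a single step, with \<open>y\<close> the fluents and actions before
  it and \<open>x\<close> the fluents after it.\<close>

definition gain ::
  "('c, 'v) action_desc \<Rightarrow> ('c, 'v) interp \<Rightarrow> ('c, 'v) interp \<Rightarrow> real" where
  "gain D y x = (\<Sum>l | l \<in> utility_laws D \<and> x \<Turnstile> fst (snd l) \<and> y \<Turnstile> snd (snd l). fst l)"

text \<open>\<open>utility_of\<close> sums over a set, so different contributions must not share an
  atom. The time stamp and the injective \<open>uid\<close> keep them apart.\<close>

lemma utility_of_run_model:
  assumes wf: "wf_action_desc D"
  shows "utility_of (run_model D m q s e p) = (\<Sum>i<m. gain D (s i \<union> e i) (s (Suc i)))"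
proof -
  define L where "L i = {l. l \<in> utility_laws D \<and> s (Suc i) \<Turnstile> fst (snd l) \<and> s i \<union> e i \<Turnstile> snd (snd l)}" for i
  define f :: "nat \<times> _ \<Rightarrow> real \<times> nat list" where "f = (\<lambda>(i, l). (fst l, [Suc i, uid D l]))"
  have "{(u, t). Utility u t \<in> run_model D m q s e p} = f ` Sigma {..<m} L"
    unfolding run_model_def L_def f_def by force
  moreover have "inj_on f (Sigma {..<m} L)"
    using inj_uid[OF wf] unfolding f_def L_def inj_on_def by auto
  ultimately have "utility_of (run_model D m q s e p) = (\<Sum>(i, l)\<in>Sigma {..<m} L. fst l)"
    unfolding utility_of_def by (simp add: sum.reindex f_def case_prod_unfold)
  also have "\<dots> = (\<Sum>i<m. \<Sum>l\<in>L i. fst l)"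
    using wf_finite(8)[OF wf] by (subst sum.Sigma) (auto simp: L_def)
  finally show ?thesis
    unfolding gain_def L_def .
qed

lemma finite_assignments:
  assumes "finite C" "\<And>c. c \<in> C \<Longrightarrow> finite (Dom D c)"
  shows "finite (assignments D C)" "x \<in> assignments D C \<Longrightarrow> finite x"
proof -
  have "atoms_over D C = Sigma C (Dom D)"
    unfolding atoms_over_def by auto
  then have "finite (atoms_over D C)"
    using assms by simp
  then show "finite (assignments D C)" "x \<in> assignments D C \<Longrightarrow> finite x"
    unfolding assignments_def by (auto intro: finite_subset)
qed

text \<open>An assignment is the graph of a function in \<open>PiE C (Dom D)\<close>, and the sum
  over such functions is an expanded product of sums, each equal to 1.\<close>

lemma sum_assignment_prob:
  assumes fin: "finite C" and dom: "\<And>c. c \<in> C \<Longrightarrow> (\<Sum>v\<in>Dom D c. prob D c v) = 1"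
    and finD: "\<And>c. c \<in> C \<Longrightarrow> finite (Dom D c)"
  shows "(\<Sum>x\<in>assignments D C. assignment_prob D x) = 1"
proof -
  define g :: "('a \<Rightarrow> 'b val) \<Rightarrow> ('a \<times> 'b val) set" where "g f = (\<lambda>c. (c, f c)) ` C" for f
  have "bij_betw g (PiE C (Dom D)) (assignments D C)"
  proof (rule bij_betwI')
    fix f f' assume f: "f \<in> PiE C (Dom D)" "f' \<in> PiE C (Dom D)"
    show "(g f = g f') = (f = f')"
    proof
      assume eq: "g f = g f'"
      have "f c = f' c" if "c \<in> C" for c
      proof -
        have "(c, f c) \<in> g f'" using that unfolding eq[symmetric] by (auto simp: g_def)
        then show ?thesis by (auto simp: g_def)
      qed
      then show "f = f'" using f by (intro PiE_ext)
    qed simp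
  next
    fix f assume "f \<in> PiE C (Dom D)"
    then show "g f \<in> assignments D C"
      by (auto simp: g_def assignments_def atoms_over_def image_iff)
  next
    fix x assume x: "x \<in> assignments D C"
    define f where "f = (\<lambda>c\<in>C. THE v. (c, v) \<in> x)"
    have f: "(c, v) \<in> x \<longleftrightarrow> v = f c" if "c \<in> C" for c v
    proof -
      have "\<exists>!v. (c, v) \<in> x" using x that by (auto simp: assignments_def)
      then show ?thesis using that theI'[of "\<lambda>v. (c, v) \<in> x"] unfolding f_def by auto
    qed
    have sub: "x \<subseteq> atoms_over D C" using x by (auto simp: assignments_def)
    have "f \<in> PiE C (Dom D)"
    proof
      fix c assume "c \<in> C"
      then show "f c \<in> Dom D c" using f sub by (auto simp: atoms_over_def)
    qed (auto simp: f_def)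
    moreover have "x = g f"
      using f sub by (auto simp: g_def atoms_over_def)
    ultimately show "\<exists>f\<in>PiE C (Dom D). x = g f" by blast
  qed
  then have "(\<Sum>x\<in>assignments D C. assignment_prob D x) = (\<Sum>f\<in>PiE C (Dom D). assignment_prob D (g f))"
    by (rule sum.reindex_bij_betw[symmetric])
  also have "\<dots> = (\<Sum>f\<in>PiE C (Dom D). \<Prod>c\<in>C. prob D c (f c))"
    unfolding assignment_prob_def g_def by (subst prod.reindex) (auto simp: inj_on_def)
  also have "\<dots> = (\<Prod>c\<in>C. \<Sum>v\<in>Dom D c. prob D c v)"
    using fin finD by (intro prod_sum_PiE[symmetric])
  also have "\<dots> = 1"
    using dom by simp
  finally show ?thesis .
qed

lemma assignment_prob_pos:
  assumes wf: "wf_action_desc D" and x: "x \<in> assignments D C" and C: "C \<subseteq> pfs D \<union> initpfs D"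
  shows "0 < assignment_prob D x"
  unfolding assignment_prob_def
proof (rule prod_pos)
  fix a assume "a \<in> x"
  then have "fst a \<in> C" "snd a \<in> Dom D (fst a)"
    using x unfolding assignments_def atoms_over_def by auto
  then show "0 < (case a of (c, v) \<Rightarrow> prob D c v)"
    using prob_pos[OF wf] C by (simp add: case_prod_unfold subset_iff)
qed

text \<open>The satisfied soft rules are the atoms of \<open>q\<close> and of the
  \<open>p i\<close>. As declared probabilities are positive, \<open>exp\<close> undoes the
  logarithms.\<close>

lemma weight_of_run_model:
  assumes wf: "wf_action_desc D" and asg: "assigned D m q s e p"
    and SM: "run_model D m q s e p \<in> SM (Tr D m)"
  shows "weight_of (Tr D m) (run_model D m q s e p) = assignment_prob D q * (\<Prod>i<m. assignment_prob D (p i))"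
proof -
  let ?I = "run_model D m q s e p"
  note D = assignedD[OF wf asg] and Int = slice_run_model_Int[OF wf asg]
  have sub: "q \<subseteq> atoms_over D (initpfs D)" "\<And>i. i < m \<Longrightarrow> p i \<subseteq> atoms_over D (pfs D)"
    using D(1,5) unfolding assignments_def by auto
  have q: "HasVal (0, c) v \<in> ?I \<longleftrightarrow> (c, v) \<in> q" if "c \<in> initpfs D" "v \<in> Dom D c" for c v
  proof -
    have "(c, v) \<in> slice 0 ?I \<longleftrightarrow> (c, v) \<in> s 0 \<union> q"
      using that unfolding Int(4)[symmetric] atoms_over_def by simp
    moreover have "(c, v) \<notin> s 0"
      using D(2)[of 0] wf_disjoint[OF wf] that unfolding assignments_def atoms_over_def by blast
    ultimately show ?thesis by simp
  qed
  have p: "HasVal (i, c) v \<in> ?I \<longleftrightarrow> (c, v) \<in> p i" if "i < m" "c \<in> pfs D" "v \<in> Dom D c" for i c v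
  proof -
    have "(c, v) \<in> slice i ?I \<longleftrightarrow> (c, v) \<in> s i \<union> e i \<union> p i"
      using that unfolding Int(3)[OF that(1), symmetric] atoms_over_def by simp
    moreover have "(c, v) \<notin> s i" "(c, v) \<notin> e i"
      using D(3,4)[OF that(1)] wf_disjoint[OF wf] that unfolding assignments_def atoms_over_def by blast+
    ultimately show ?thesis by simp
  qed
  have q': "c \<in> initpfs D \<and> v \<in> Dom D c \<and> HasVal (0, c) v \<in> ?I \<longleftrightarrow> (c, v) \<in> q" for c v
    using q[of c v] sub(1) unfolding atoms_over_def by blast
  have p': "i < m \<and> c \<in> pfs D \<and> v \<in> Dom D c \<and> HasVal (i, c) v \<in> ?I \<longleftrightarrow>
      i < m \<and> (c, v) \<in> p i" for i c v
    using p[of i c v] sub(2)[of i] unfolding atoms_over_def by blast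
  \<comment> \<open>The atom in the second component records time, constant and value, so equal
    logarithms from different declarations remain separate summands.\<close>
  define f :: "nat \<Rightarrow> 'a \<times> 'b val \<Rightarrow> real \<times> (nat \<times> 'a, 'b val) atom form"
    where "f i = (\<lambda>(c, v). (ln (prob D c v), Atom (HasVal (i, c) v)))" for i
  have set_eq: "{(w, R). (Soft w, R) \<in> Tr D m \<and> ?I \<Turnstile> R} = f 0 ` q \<union> (\<Union>i<m. f i ` p i)"
  proof -
    have "(Soft w, R) \<in> Tr D m \<longleftrightarrow> (\<exists>c r v. w = ln (r v) \<and> R = Atom (HasVal c v) \<and>
        (c, r) \<in> Tr_decls D m \<and> v \<in> tDom D c)" for w R
      unfolding Tr_eq_mvpp mvpp_def by simp
    then have "{(w, R). (Soft w, R) \<in> Tr D m \<and> ?I \<Turnstile> R} =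
        {(ln (r v), Atom (HasVal c v)) | c r v. (c, r) \<in> Tr_decls D m \<and> v \<in> tDom D c \<and> HasVal c v \<in> ?I}"
      by auto
    also have "\<dots> = {f 0 (c, v) | c v. c \<in> initpfs D \<and> v \<in> Dom D c \<and> HasVal (0, c) v \<in> ?I} \<union>
        {f i (c, v) | i c v. i < m \<and> c \<in> pfs D \<and> v \<in> Dom D c \<and> HasVal (i, c) v \<in> ?I}"
      unfolding Tr_decls_def tDom_def f_def by auto
    also have "{f 0 (c, v) | c v. c \<in> initpfs D \<and> v \<in> Dom D c \<and> HasVal (0, c) v \<in> ?I} = f 0 ` q"
      unfolding q' by force
    also have "{f i (c, v) | i c v. i < m \<and> c \<in> pfs D \<and> v \<in> Dom D c \<and> HasVal (i, c) v \<in> ?I} =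
        (\<Union>i<m. f i ` p i)"
      unfolding p' by force
    finally show ?thesis .
  qed
  have fin: "finite q" "\<And>i. i < m \<Longrightarrow> finite (p i)"
    using finite_assignments(2)[OF wf_finite(4)[OF wf] _ D(1)]
      finite_assignments(2)[OF wf_finite(3)[OF wf] _ D(5)] finite_Dom[OF wf] by auto
  have inj: "inj_on (f i) x" for i x
    unfolding f_def inj_on_def by auto
  have disj: "f i ` p i \<inter> f j ` p j = {}" if "i \<noteq> j" for i j
    using that unfolding f_def by auto
  \<comment> \<open>Time 0 carries both kinds of declarations; disjointness of pf and initpf
    constants separates them.\<close>
  have disj0: "f 0 ` q \<inter> (\<Union>i<m. f i ` p i) = {}"
  proof -
    have "a = b" if "f i a = f j b" for i j a b
      using that unfolding f_def by (auto split: prod.splits)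
    moreover have "q \<inter> p i = {}" if "i < m" for i
      using sub(1) sub(2)[OF that] wf_disjoint(6)[OF wf] unfolding atoms_over_def by blast
    ultimately show ?thesis by blast
  qed
  have exp_sum_f: "exp (\<Sum>(w, R)\<in>f i ` x. w) = assignment_prob D x" if "finite x" "x \<subseteq> atoms_over D (pfs D \<union> initpfs D)" for i x
  proof -
    have "(\<Sum>(w, R)\<in>f i ` x. w) = (\<Sum>(c, v)\<in>x. ln (prob D c v))"
      by (subst sum.reindex[OF inj]) (simp add: f_def case_prod_unfold)
    then have "exp (\<Sum>(w, R)\<in>f i ` x. w) = (\<Prod>(c, v)\<in>x. exp (ln (prob D c v)))"
      using that(1) by (simp add: exp_sum case_prod_unfold)
    also have "\<dots> = assignment_prob D x"
      unfolding assignment_prob_def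
      by (rule prod.cong) (use that(2) prob_pos[OF wf] in \<open>auto simp: atoms_over_def\<close>)
    finally show ?thesis .
  qed
  have "weight_of (Tr D m) ?I = exp ((\<Sum>(w, R)\<in>f 0 ` q. w) + (\<Sum>i<m. \<Sum>(w, R)\<in>f i ` p i. w))"
    unfolding weight_of_def set_eq using SM fin disj disj0
    by (simp add: sum.union_disjoint sum.UNION_disjoint)
  also have "\<dots> = assignment_prob D q * (\<Prod>i<m. assignment_prob D (p i))"
    unfolding exp_add exp_sum[OF finite_lessThan] using fin sub
    by (intro arg_cong2[where f = "(*)"] prod.cong refl exp_sum_f)
      (simp_all add: atoms_over_Un le_supI1 le_supI2)
  finally show ?thesis .
qed

section \<open>Expectations as sums over paths\<close>

lemma wf_finite_assignments:
  assumes wf: "wf_action_desc D"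
  shows "finite (assignments D (initpfs D))" "finite (assignments D (actions D))"
    "finite (assignments D (pfs D))" "finite (assignments D (fluents D))"
  using wf_finite[OF wf] finite_Dom[OF wf] by (auto intro!: finite_assignments(1))

lemma finite_runs:
  assumes wf: "wf_action_desc D"
  shows "finite (runs D m)" "finite (Collect (is_state D))"
proof -
  note fin_asg = wf_finite_assignments[OF wf]
  show S: "finite (Collect (is_state D))"
    by (intro finite_subset[OF _ fin_asg(4)]) (auto simp: is_state_def)
  have "runs D m \<subseteq> (assignments D (initpfs D) \<times> ({0..m} \<rightarrow>\<^sub>E Collect (is_state D))) \<times>
      (({..<m} \<rightarrow>\<^sub>E assignments D (actions D)) \<times> ({..<m} \<rightarrow>\<^sub>E assignments D (pfs D)))"
    unfolding runs_def by blast
  then show "finite (runs D m)"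
    using fin_asg S by (elim finite_subset) (intro finite_SigmaI finite_PiE; simp)
qed

lemma finite_SM_Tr: "wf_action_desc D \<Longrightarrow> finite (SM (Tr D m))"
  unfolding SM_Tr_eq_runs by (intro finite_imageI finite_runs)

lemma sum_weight_of_pos:
  assumes "finite (SM P)" "SM P \<noteq> {}"
  shows "0 < (\<Sum>I\<in>SM P. weight_of P I)"
  using assms by (intro sum_pos) (auto simp: weight_of_def)

lemma prob_form_eq:
  "prob_form P F = (\<Sum>I | I \<in> SM P \<and> I \<Turnstile> F. weight_of P I) / (\<Sum>I\<in>SM P. weight_of P I)"
  unfolding prob_form_def prob_int_def sum_divide_distrib ..

text \<open>The global normaliser cancels. Without stable models both sides are 0, by the convention
  on division.\<close>

lemma cond_prob_form_eq:
  assumes "finite (SM P)"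
  shows "cond_prob_form P F G = (\<Sum>I | I \<in> SM P \<and> I \<Turnstile> And F G. weight_of P I) /
     (\<Sum>I | I \<in> SM P \<and> I \<Turnstile> G. weight_of P I)"
proof (cases "SM P = {}")
  case True
  then show ?thesis by (simp add: cond_prob_form_def prob_form_def)
next
  case False
  then show ?thesis
    using sum_weight_of_pos[OF assms False] unfolding cond_prob_form_def prob_form_eq by simp
qed

lemma expected_utility_eq:
  assumes "finite (SM P)"
  shows "expected_utility P A = (\<Sum>I | I \<in> SM P \<and> I \<Turnstile> A. utility_of I * weight_of P I) /
     (\<Sum>I | I \<in> SM P \<and> I \<Turnstile> A. weight_of P I)"
proof (cases "SM P = {}")
  case True
  then show ?thesis by (simp add: expected_utility_def)
next
  case False
  let ?Z = "\<Sum>I\<in>SM P. weight_of P I" and ?A = "\<Sum>I | I \<in> SM P \<and> I \<Turnstile> A. weight_of P I"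
  have "expected_utility P A =
      (\<Sum>I | I \<in> SM P \<and> I \<Turnstile> A. utility_of I * weight_of P I / ?A)"
    unfolding expected_utility_def cond_prob_int_def prob_form_eq prob_int_def
    using sum_weight_of_pos[OF assms False] by (intro sum.cong) auto
  then show ?thesis
    by (simp add: sum_divide_distrib)
qed

text \<open>This becomes the transition probability of the MDP. It avoids stable models so that
  programs of every horizon factor through it.\<close>

definition step_prob ::
  "('c, 'v) action_desc \<Rightarrow> ('c, 'v) interp \<Rightarrow> ('c, 'v) interp \<Rightarrow> ('c, 'v) interp \<Rightarrow> real" where
  "step_prob D x a y = (\<Sum>p | p \<in> assignments D (pfs D) \<and> is_step D (x \<union> a \<union> p) y. assignment_prob D p)"

text \<open>Depends on neither the policy nor the horizon, which is why it can cancel.\<close>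

definition init_mass :: "('c, 'v) action_desc \<Rightarrow> ('c, 'v) interp \<Rightarrow> real" where
  "init_mass D x = (\<Sum>q | q \<in> assignments D (initpfs D) \<and> init_ok D (x \<union> q). assignment_prob D q)"

text \<open>Once \<open>A\<close> fixes the start and makes the actions follow \<open>\<pi>\<close>,
  a run is a path with an initpf assignment and, for each step, a pf assignment chosen
  independently. \<open>B\<close> leaves room for further conditions on the path; the factor
  \<open>g\<close> covers numerators as well as denominators.\<close>

lemma sum_SM_Tr:
  assumes wf: "wf_action_desc D"
    and \<pi>: "\<And>x i. is_state D x \<Longrightarrow> i < m \<Longrightarrow> \<pi> (x, i) \<in> assignments D (actions D)"
    and A: "\<And>q s e p. ((q, s), (e, p)) \<in> runs D m \<Longrightarrow>
      run_model D m q s e p \<Turnstile> A \<longleftrightarrow> s 0 = s0 \<and> (\<forall>i<m. e i = \<pi> (s i, i)) \<and> B s"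
    and h: "\<And>q s e p. ((q, s), (e, p)) \<in> runs D m \<Longrightarrow> run_model D m q s e p \<Turnstile> A \<Longrightarrow>
      h (run_model D m q s e p) = g s * weight_of (Tr D m) (run_model D m q s e p)"
  shows "(\<Sum>I | I \<in> SM (Tr D m) \<and> I \<Turnstile> A. h I) = init_mass D s0 *
    (\<Sum>s | s \<in> {0..m} \<rightarrow>\<^sub>E Collect (is_state D) \<and> s 0 = s0 \<and> B s.
       g s * (\<Prod>i<m. step_prob D (s i) (\<pi> (s i, i)) (s (Suc i))))"
proof -
  let ?M = "model_of_run D m"
  define Q where "Q = {q. q \<in> assignments D (initpfs D) \<and> init_ok D (s0 \<union> q)}"
  define S where "S = {s. s \<in> {0..m} \<rightarrow>\<^sub>E Collect (is_state D) \<and> s 0 = s0 \<and> B s}"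
  define E where "E s = (\<lambda>i\<in>{..<m}. \<pi> (s i, i))" for s
  define R where "R s i = {p \<in> assignments D (pfs D). is_step D (s i \<union> \<pi> (s i, i) \<union> p) (s (Suc i))}"
    for s i
  \<comment> \<open>For a fixed path, each \<open>p i\<close> ranges over a set of its own,
    \<open>R s i\<close>; hence the dependent product.\<close>
  define X where "X = Sigma (Q \<times> S) (\<lambda>(q, s). PiE {..<m} (R s))"
  define F where "F = (\<lambda>((q :: ('a \<times> 'b val) set, s), p :: nat \<Rightarrow> ('a \<times> 'b val) set). ((q, s), (E s, p)))"
  have finR: "finite (R s i)" for s i
    unfolding R_def using wf_finite_assignments(3)[OF wf] by simp
  have finQ: "finite Q"
    unfolding Q_def using wf_finite_assignments(1)[OF wf] by simp
  have "finite ({0..m} \<rightarrow>\<^sub>E Collect (is_state D))"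
    using finite_runs(2)[OF wf] by (intro finite_PiE) auto
  then have finS: "finite S"
    unfolding S_def by (rule rev_finite_subset) auto
  have runs_eq: "{r \<in> runs D m. ?M r \<Turnstile> A} = F ` X"
  proof (intro equalityI subsetI)
    fix r assume r: "r \<in> {r \<in> runs D m. ?M r \<Turnstile> A}"
    obtain q s e p where r_eq: "r = ((q, s), (e, p))"
      by (metis surj_pair)
    have run: "((q, s), (e, p)) \<in> runs D m" and sat: "s 0 = s0" "\<forall>i<m. e i = \<pi> (s i, i)" "B s"
      using r A unfolding r_eq by auto
    have "e = E s"
      using run sat(2) unfolding runs_def E_def by (intro extensionalityI[of _ "{..<m}"]) (auto simp: PiE_def)
    moreover have "((q, s), p) \<in> X"
      using run sat unfolding runs_def X_def Q_def S_def R_def by (auto simp: PiE_iff)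
    ultimately show "r \<in> F ` X"
      unfolding r_eq F_def by (intro image_eqI[of _ _ "((q, s), p)"]) auto
  next
    fix r assume "r \<in> F ` X"
    then obtain q s p where r_eq: "r = ((q, s), (E s, p))" and qsp: "q \<in> Q" "s \<in> S" "p \<in> PiE {..<m} (R s)"
      unfolding F_def X_def by auto
    have "((q, s), (E s, p)) \<in> runs D m"
      using qsp \<pi> unfolding runs_def Q_def S_def R_def E_def by (auto simp: PiE_iff)
    moreover from this have "run_model D m q s (E s) p \<Turnstile> A"
      using A qsp unfolding S_def E_def by auto
    ultimately show "r \<in> {r \<in> runs D m. ?M r \<Turnstile> A}"
      unfolding r_eq by simp
  qed
  have injF: "inj_on F X"
    unfolding F_def inj_on_def by auto
  have "{I. I \<in> SM (Tr D m) \<and> I \<Turnstile> A} = ?M ` {r \<in> runs D m. ?M r \<Turnstile> A}"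
    unfolding SM_Tr_eq_runs[OF wf] by blast
  then have "(\<Sum>I | I \<in> SM (Tr D m) \<and> I \<Turnstile> A. h I) = (\<Sum>r | r \<in> runs D m \<and> ?M r \<Turnstile> A. h (?M r))"
    using inj_on_subset[OF inj_on_model_of_run[OF wf]] by (simp add: sum.reindex)
  also have "\<dots> = (\<Sum>x\<in>X. h (?M (F x)))"
    unfolding runs_eq by (simp add: sum.reindex[OF injF])
  also have "\<dots> = (\<Sum>((q, s), p)\<in>X. assignment_prob D q * (g s * (\<Prod>i<m. assignment_prob D (p i))))"
  proof (rule sum.cong)
    fix x assume x: "x \<in> X"
    obtain q s p where x_eq: "x = ((q, s), p)"
      by (metis surj_pair)
    have run: "((q, s), (E s, p)) \<in> runs D m" and sat: "run_model D m q s (E s) p \<Turnstile> A"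
      using runs_eq x unfolding x_eq F_def by force+
    have "run_model D m q s (E s) p \<in> SM (Tr D m)"
      unfolding SM_Tr_eq_runs[OF wf] using run by force
    then show "h (?M (F x)) = (\<lambda>((q, s), p). assignment_prob D q * (g s * (\<Prod>i<m. assignment_prob D (p i)))) x"
      using h[OF run sat] weight_of_run_model[OF wf assigned_of_run[OF run]]
      unfolding x_eq F_def by simp
  qed simp
  also have "\<dots> = (\<Sum>(q, s)\<in>Q \<times> S. \<Sum>p\<in>PiE {..<m} (R s). assignment_prob D q * (g s * (\<Prod>i<m. assignment_prob D (p i))))"
    unfolding X_def using finQ finS finR
    by (subst sum.Sigma[symmetric]) (auto intro!: finite_PiE sum.cong)
  also have "\<dots> = (\<Sum>(q, s)\<in>Q \<times> S. assignment_prob D q * (g s * (\<Prod>i<m. step_prob D (s i) (\<pi> (s i, i)) (s (Suc i)))))"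
  proof -
    \<comment> \<open>With the path held fixed, the sum over pf sequences factors step by
      step.\<close>
    have "(\<Sum>p\<in>PiE {..<m} (R s). \<Prod>i<m. assignment_prob D (p i)) = (\<Prod>i<m. step_prob D (s i) (\<pi> (s i, i)) (s (Suc i)))" for s
      unfolding step_prob_def R_def[symmetric] using finR by (intro prod_sum_PiE[symmetric]) auto
    then show ?thesis
      by (simp add: sum_distrib_left[symmetric])
  qed
  also have "\<dots> = init_mass D s0 *
      (\<Sum>s\<in>S. g s * (\<Prod>i<m. step_prob D (s i) (\<pi> (s i, i)) (s (Suc i))))"
    unfolding init_mass_def Q_def[symmetric] by (simp add: sum.cartesian_product[symmetric] sum_product)
  finally show ?thesis
    unfolding S_def .
qed

text \<open>The total mass of a time-inhomogeneous Markov chain. The induction sums out the last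
  state, where the row sum of the last kernel is 1.\<close>

lemma sum_prod_paths:
  fixes k :: "nat \<Rightarrow> 's \<Rightarrow> 's \<Rightarrow> real"
  assumes "finite S" and "x0 \<in> S" and "\<And>i x. i < m \<Longrightarrow> x \<in> S \<Longrightarrow> (\<Sum>y\<in>S. k i x y) = 1"
  shows "(\<Sum>s | s \<in> {0..m} \<rightarrow>\<^sub>E S \<and> s 0 = x0. \<Prod>i<m. k i (s i) (s (Suc i))) = 1"
  using assms(3)
proof (induction m)
  case 0
  have "{s. s \<in> {0..0::nat} \<rightarrow>\<^sub>E S \<and> s 0 = x0} = {\<lambda>i\<in>{0}. x0}"
    using assms(2) by (auto simp: PiE_iff intro: extensionalityI[of _ "{0}"])
  then show ?case by simp
next
  case (Suc m)
  let ?P = "\<lambda>m. {s. s \<in> {0..m} \<rightarrow>\<^sub>E S \<and> s 0 = x0}"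
  define f where "f = (\<lambda>(y, s). s(Suc m := y) :: nat \<Rightarrow> 's)"
  have eq: "?P (Suc m) = f ` (S \<times> ?P m)"
  proof -
    have ins: "{0..Suc m} \<rightarrow>\<^sub>E S = f ` (S \<times> ({0..m} \<rightarrow>\<^sub>E S))"
      unfolding f_def using PiE_insert_eq[of "Suc m" "{0..m}" "\<lambda>_. S"] by (simp add: atLeast0_atMost_Suc)
    have "?P (Suc m) = f ` {a \<in> S \<times> ({0..m} \<rightarrow>\<^sub>E S). f a 0 = x0}"
      unfolding ins by blast
    also have "{a \<in> S \<times> ({0..m} \<rightarrow>\<^sub>E S). f a 0 = x0} = S \<times> ?P m"
      unfolding f_def by auto
    finally show ?thesis .
  qed
  have "inj_on f (S \<times> ({0..m} \<rightarrow>\<^sub>E S))"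
    unfolding f_def by (rule inj_combinator) simp
  then have inj: "inj_on f (S \<times> ?P m)"
    by (rule inj_on_subset) auto
  have "(\<Sum>s\<in>?P (Suc m). \<Prod>i<Suc m. k i (s i) (s (Suc i))) =
      (\<Sum>(y, s)\<in>S \<times> ?P m. (\<Prod>i<m. k i (s i) (s (Suc i))) * k m (s m) y)"
    unfolding eq by (subst sum.reindex[OF inj]) (auto simp: f_def intro!: sum.cong prod.cong)
  also have "\<dots> = (\<Sum>y\<in>S. \<Sum>s\<in>?P m. (\<Prod>i<m. k i (s i) (s (Suc i))) * k m (s m) y)"
    by (simp add: sum.cartesian_product)
  also have "\<dots> = (\<Sum>s\<in>?P m. (\<Prod>i<m. k i (s i) (s (Suc i))) * (\<Sum>y\<in>S. k m (s m) y))"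
    by (subst sum.swap) (simp add: sum_distrib_left)
  also have "\<dots> = (\<Sum>s\<in>?P m. \<Prod>i<m. k i (s i) (s (Suc i)))"
    using Suc.prems by (intro sum.cong) (auto simp: PiE_iff)
  also have "\<dots> = 1"
    using Suc by simp
  finally show ?case by simp
qed

section \<open>The Markov decision process\<close>

text \<open>Without initpf constants and initial laws, \<^term>\<open>Tr D m\<close> is just \<^term>\<open>D_prog D m\<close>, so that
  the analysis of \<^term>\<open>Tr\<close> also covers the programs that define states and transitions.\<close>

definition forget_init :: "('c, 'v) action_desc \<Rightarrow> ('c, 'v) action_desc" where
  "forget_init D = D\<lparr>initpfs := {}, initial_laws := {}\<rparr>"

lemma forget_init_simps [simp]:
  "regular (forget_init D) = regular D" "statdet (forget_init D) = statdet D"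
  "actions (forget_init D) = actions D" "pfs (forget_init D) = pfs D"
  "initpfs (forget_init D) = {}" "Dom (forget_init D) = Dom D" "prob (forget_init D) = prob D"
  "static_laws (forget_init D) = static_laws D" "dynamic_laws (forget_init D) = dynamic_laws D"
  "initial_laws (forget_init D) = {}" "utility_laws (forget_init D) = utility_laws D"
  "uid (forget_init D) = uid D"
  by (simp_all add: forget_init_def)

lemma forget_init_vocabulary [simp]:
  "fluents (forget_init D) = fluents D" "atoms_over (forget_init D) = atoms_over D"
  "tDom (forget_init D) = tDom D" "assignment_prob (forget_init D) = assignment_prob D"
  unfolding fluents_def atoms_over_def tDom_def assignment_prob_def forget_init_simps by (rule refl)+

lemma forget_init_derived [simp]:
  "form_over (forget_init D) = form_over D" "assignments (forget_init D) = assignments D"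
  "static_red (forget_init D) = static_red D" "dynamic_red (forget_init D) = dynamic_red D"
  "run_model (forget_init D) = run_model D" "D_rules (forget_init D) = D_rules D"
  by (intro ext, simp only: form_over_def assignments_def static_red_def dynamic_red_def
      run_model_def D_rules_def forget_init_simps forget_init_vocabulary)+

lemma forget_init_semantics [simp]:
  "is_state (forget_init D) = is_state D" "is_step (forget_init D) = is_step D"
  "init_ok (forget_init D) x" "D_prog (forget_init D) = D_prog D"
  by (intro ext, simp only: is_state_def is_step_def D_prog_def forget_init_simps
      forget_init_vocabulary forget_init_derived | simp add: init_ok_def)+

lemma step_prob_forget_init [simp]: "step_prob (forget_init D) = step_prob D"
  by (intro ext) (simp add: step_prob_def)

lemma wf_forget_init:
  "wf_action_desc D \<Longrightarrow> wf_action_desc (forget_init D)"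
  unfolding wf_action_desc_def forget_init_simps forget_init_vocabulary forget_init_derived
  by (elim conjE) (intro conjI; simp?)

lemma D_prog_eq_Tr: "D_prog D m = Tr (forget_init D) m"
proof -
  have "Tr_consts (forget_init D) m =
      {(i, c). i \<le> m \<and> c \<in> fluents D} \<union> {(i, c). i < m \<and> c \<in> actions D \<union> pfs D}"
    by (auto simp: Tr_consts_def)
  then show ?thesis
    unfolding Tr_eq_mvpp D_prog_def
    by (simp add: Tr_decls_def Tr_rules_def D_rules_def)
qed

lemma assignments_empty [simp]: "assignments D {} = {{}}"
  by (auto simp: assignments_def atoms_over_def)

text \<open>Assignments over the same constants form an antichain. Hence a true conjunction
  \<open>stamp_conj\<close> pins down the whole component of a run.\<close>

lemma assignments_subset_eq:
  assumes "x \<in> assignments D C" "y \<in> assignments D C" "x \<subseteq> y"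
  shows "x = y"
proof (rule equalityI[OF assms(3)]; rule subsetI)
  fix a assume "a \<in> y"
  moreover obtain c v where a: "a = (c, v)" by (cases a)
  ultimately have "c \<in> C" using assms(2) by (auto simp: assignments_def atoms_over_def)
  then obtain v' where "(c, v') \<in> x" "\<exists>!w. (c, w) \<in> y"
    using assms(1,2) unfolding assignments_def by blast
  then show "a \<in> x" using assms(3) \<open>a \<in> y\<close> unfolding a by blast
qed

lemma stamp_set_eq_iff [simp]: "stamp_set i x = stamp_set i y \<longleftrightarrow> x = y"
proof -
  have "slice i (stamp_set i z) = z" for z :: "('a \<times> 'b val) set"
    by auto
  then show ?thesis by metis
qed

lemma sat_stamp_conj: "finite x \<Longrightarrow> I \<Turnstile> stamp_conj i x \<longleftrightarrow> x \<subseteq> slice i I"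
  unfolding stamp_conj_def by (subst sat_BigAnd) auto

lemma at_most_one_true_of_transition:
  "standing_assumptions D \<Longrightarrow> transition D s e s' \<Longrightarrow> at_most_one_true e"
  unfolding standing_assumptions_def by (drule conjunct1) blast

lemma ex1_pf_transition:
  "standing_assumptions D \<Longrightarrow> s \<in> states D \<Longrightarrow> e \<in> assignments D (actions D) \<Longrightarrow>
     pf \<in> assignments D (pfs D) \<Longrightarrow> at_most_one_true e \<Longrightarrow>
     \<exists>!s'. s' \<in> states D \<and> pf_transition D s e s' pf"
  unfolding standing_assumptions_def by (drule conjunct2, drule conjunct1) blast

section \<open>States, actions and transitions in terms of steps\<close>

context
  fixes D :: "('c, 'v) action_desc"
  assumes wf: "wf_action_desc D"
begin

lemma sat_stamp_conj_fluents:
  assumes "assigned D m q s e p" "i \<le> m" "x \<in> assignments D (fluents D)"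
  shows "run_model D m q s e p \<Turnstile> stamp_conj i x \<longleftrightarrow> s i = x"
proof -
  have "finite x"
    using finite_assignments(2)[OF wf_finite(1)[OF wf] _ assms(3)] finite_Dom[OF wf] by auto
  moreover have "x \<subseteq> slice i (run_model D m q s e p) \<longleftrightarrow> x \<subseteq> s i"
    unfolding slice_run_model_Int(1)[OF wf assms(1,2), symmetric]
    using assms(3) unfolding assignments_def by auto
  moreover have "x \<subseteq> s i \<longleftrightarrow> s i = x"
    using assignments_subset_eq[OF assms(3) assignedD(2)[OF wf assms(1,2)]] by auto
  ultimately show ?thesis
    by (simp only: sat_stamp_conj)
qed

lemma sat_stamp_conj_actions:
  assumes "assigned D m q s e p" "i < m" "a \<in> assignments D (actions D)"
  shows "run_model D m q s e p \<Turnstile> stamp_conj i a \<longleftrightarrow> e i = a"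
proof -
  have "finite a"
    using finite_assignments(2)[OF wf_finite(2)[OF wf] _ assms(3)] finite_Dom[OF wf] by auto
  moreover have "a \<subseteq> slice i (run_model D m q s e p) \<longleftrightarrow> a \<subseteq> s i \<union> e i"
    unfolding slice_run_model_Int(2)[OF wf assms(1,2), symmetric]
    using assms(3) unfolding assignments_def atoms_over_def by auto
  moreover have "a \<subseteq> s i \<union> e i \<longleftrightarrow> a \<subseteq> e i"
    using assms(3) assignedD(3)[OF wf assms(1,2)] wf_disjoint(1)[OF wf]
    unfolding assignments_def atoms_over_def by blast
  moreover have "a \<subseteq> e i \<longleftrightarrow> e i = a"
    using assignments_subset_eq[OF assms(3) assignedD(4)[OF wf assms(1,2)]] by auto
  ultimately show ?thesis
    by (simp only: sat_stamp_conj)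
qed

lemma SM_D_prog_iff:
  assumes "assigned (forget_init D) m {} s e p"
  shows "run_model D m {} s e p \<in> SM (D_prog D m) \<longleftrightarrow>
     is_state D (s 0) \<and> (\<forall>i<m. is_step D (s i \<union> e i \<union> p i) (s (Suc i)))"
  using run_model_in_SM_Tr_iff[OF wf_forget_init[OF wf] assms] unfolding D_prog_eq_Tr by simp

lemma ex_run_of_SM_D_prog:
  assumes "I \<in> SM (D_prog D m)"
  shows "\<exists>s e p. assigned (forget_init D) m {} s e p \<and> I = run_model D m {} s e p"
proof -
  obtain q s e p where "assigned (forget_init D) m q s e p" "I = run_model (forget_init D) m q s e p"
    using ex_run_of_SM_Tr[OF wf_forget_init[OF wf], of I m] assms unfolding D_prog_eq_Tr by blast
  moreover from this have "q = {}"
    unfolding assigned_def by simp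
  ultimately show ?thesis by auto
qed

lemma assigned_forget_init:
  "assigned (forget_init D) m {} s e p \<longleftrightarrow> (\<forall>i\<le>m. s i \<in> assignments D (fluents D)) \<and>
     (\<forall>i<m. e i \<in> assignments D (actions D) \<and> p i \<in> assignments D (pfs D))"
  unfolding assigned_def by simp

text \<open>At horizon 0 the model of a run is the stamped state alone, without actions, pf values
  or utility atoms.\<close>

lemma states_eq: "states D = Collect (is_state D)"
proof (intro equalityI subsetI; unfold mem_Collect_eq)
  let ?FL = "atoms_over D (fluents D)"
  have Int: "I \<inter> stamp_set 0 ?FL = stamp_set 0 (slice 0 I \<inter> ?FL)" for I
    by auto
  fix x
  {
    assume "x \<in> states D"
    then obtain I where I: "I \<in> SM (D_prog D 0)" "I \<inter> stamp_set 0 ?FL = stamp_set 0 x"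
      unfolding states_def residual_stable_model_def by blast
    obtain s e p where asg: "assigned (forget_init D) 0 {} s e p" and eq: "I = run_model D 0 {} s e p"
      using ex_run_of_SM_D_prog[OF I(1)] by blast
    have "slice 0 I \<inter> ?FL = s 0"
      using slice_run_model_Int(1)[OF wf_forget_init[OF wf] asg, of 0] unfolding eq by simp
    then have "x = s 0"
      using I(2) unfolding Int by simp
    then show "is_state D x"
      using I(1) SM_D_prog_iff[OF asg] unfolding eq by simp
  next
    assume x: "is_state D x"
    \<comment> \<open>The empty action and pf values are placeholders: horizon 0 never evaluates
      them.\<close>
    let ?I = "run_model D 0 {} (\<lambda>_. x) (\<lambda>_. {}) (\<lambda>_. {})"
    have asg: "assigned (forget_init D) 0 {} (\<lambda>_. x) (\<lambda>_. {}) (\<lambda>_. {})"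
      using x unfolding assigned_forget_init is_state_def by simp
    have "?I \<in> SM (D_prog D 0)"
      using x SM_D_prog_iff[OF asg] by simp
    moreover have "slice 0 ?I \<inter> ?FL = x"
      using slice_run_model_Int(1)[OF wf_forget_init[OF wf] asg, of 0] by simp
    moreover have "x \<subseteq> ?FL"
      using x unfolding is_state_def assignments_def by blast
    ultimately show "x \<in> states D"
      unfolding states_def residual_stable_model_def using Int[of ?I] by auto
  }
qed

lemma transition_of_run:
  assumes asg: "assigned (forget_init D) 1 {} s e p"
    and I: "run_model D 1 {} s e p \<in> SM (D_prog D 1)"
  shows "transition D (s 0) (e 0) (s 1)"
proof -
  let ?I = "run_model D 1 {} s e p"
  let ?FL = "atoms_over D (fluents D)" and ?AC = "atoms_over D (actions D)"
  let ?\<sigma> = "stamp_set 0 ?FL \<union> stamp_set 0 ?AC \<union> stamp_set 1 ?FL"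
  note slices = slice_run_model_Int[OF wf_forget_init[OF wf] asg, unfolded forget_init_derived
      forget_init_simps forget_init_vocabulary]
  have "?I \<inter> ?\<sigma> = stamp_set 0 (slice 0 ?I \<inter> (?FL \<union> ?AC)) \<union> stamp_set 1 (slice 1 ?I \<inter> ?FL)"
    by auto
  also have "\<dots> = stamp_set 0 (s 0) \<union> stamp_set 0 (e 0) \<union> stamp_set 1 (s 1)"
    using slices(1)[of 1] slices(2)[of 0] by (simp add: atoms_over_Un image_Un)
  finally have "?I \<inter> ?\<sigma> = stamp_set 0 (s 0) \<union> stamp_set 0 (e 0) \<union> stamp_set 1 (s 1)" .
  moreover have "s 0 \<subseteq> ?FL" "e 0 \<subseteq> ?AC" "s 1 \<subseteq> ?FL"
    using asg unfolding assigned_forget_init assignments_def by auto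
  ultimately show ?thesis
    using I unfolding transition_def residual_stable_model_def by (intro conjI bexI[of _ ?I]) auto
qed

text \<open>An action interpretation is the action part of a stable model of
  \<open>D_prog D 1\<close>, hence occurs in a transition, to which the first standing assumption
  applies.\<close>

lemma act_interpsD:
  assumes "standing_assumptions D" "a \<in> act_interps D"
  shows "a \<in> assignments D (actions D)" "at_most_one_true a"
proof -
  let ?AC = "atoms_over D (actions D)"
  have Int: "I \<inter> stamp_set 0 ?AC = stamp_set 0 (slice 0 I \<inter> ?AC)" for I
    by auto
  obtain I where I: "I \<in> SM (D_prog D 1)" "I \<inter> stamp_set 0 ?AC = stamp_set 0 a"
    using assms(2) unfolding act_interps_def residual_stable_model_def by blast
  obtain s e p where asg: "assigned (forget_init D) 1 {} s e p" and eq: "I = run_model D 1 {} s e p"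
    using ex_run_of_SM_D_prog[OF I(1)] by blast
  have e: "e 0 \<in> assignments D (actions D)" and s: "s 0 \<in> assignments D (fluents D)"
    using asg unfolding assigned_forget_init by auto
  have "slice 0 I \<inter> atoms_over D (fluents D \<union> actions D) = s 0 \<union> e 0"
    using slice_run_model_Int(2)[OF wf_forget_init[OF wf] asg, of 0] unfolding eq by simp
  moreover have "s 0 \<inter> ?AC = {}"
    using s wf_disjoint(1)[OF wf] by (rule assignments_Int_atoms_over_disjoint)
  moreover have "e 0 \<inter> ?AC = e 0"
    using e order_refl by (rule assignments_Int_atoms_over)
  ultimately have "slice 0 I \<inter> ?AC = e 0"
    unfolding atoms_over_Un by blast
  then have "a = e 0"
    using I(2) unfolding Int by simp
  then show "a \<in> assignments D (actions D)" "at_most_one_true a"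
    using e at_most_one_true_of_transition[OF assms(1) transition_of_run[OF asg I(1)[unfolded eq]]]
    by auto
qed

text \<open>\<open>determined_utility\<close> adds exactly the utility atoms of the one-step run, so
  the run criterion decides stability; \<open>transition_of_run\<close> supplies the
  transition.\<close>

lemma pf_transition_iff_is_step:
  assumes x: "x \<in> states D" and a: "a \<in> assignments D (actions D)"
    and p: "p \<in> assignments D (pfs D)" and y: "y \<in> states D"
  shows "pf_transition D x a y p \<longleftrightarrow> is_step D (x \<union> a \<union> p) y"
proof -
  define s where "s = (\<lambda>i::nat. if i = 0 then x else y)"
  define I where "I = stamp_set 0 x \<union> stamp_set 0 a \<union> stamp_set 1 y \<union> stamp_set 0 p"
  have fl: "x \<in> assignments D (fluents D)" "y \<in> assignments D (fluents D)"
    using x y unfolding states_eq is_state_def by auto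
  have asg: "assigned (forget_init D) 1 {} s (\<lambda>_. a) (\<lambda>_. p)"
    using fl a p unfolding assigned_forget_init s_def by simp
  have G: "slice 0 I \<Turnstile> G \<longleftrightarrow> x \<union> a \<Turnstile> G" if "form_over D (fluents D \<union> actions D) G" for G
  proof (rule sat_restrict[OF that])
    have "slice 0 I = x \<union> a \<union> p"
      unfolding I_def by auto
    moreover have "x \<subseteq> atoms_over D (fluents D \<union> actions D)"
      "a \<subseteq> atoms_over D (fluents D \<union> actions D)"
      using fl(1) a unfolding assignments_def atoms_over_Un by auto
    moreover have "p \<inter> atoms_over D (fluents D \<union> actions D) = {}"
      using p wf_disjoint[OF wf] by (intro assignments_Int_atoms_over_disjoint) auto
    ultimately show "slice 0 I \<inter> atoms_over D (fluents D \<union> actions D) = x \<union> a"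
      by blast
  qed
  have "slice 1 I = y"
    unfolding I_def by auto
  then have "determined_utility D I = {Utility v [Suc i, uid D (v, F, G)] | i v F G. i < 1 \<and>
      (v, F, G) \<in> utility_laws D \<and> s (Suc i) \<Turnstile> F \<and> s i \<union> a \<Turnstile> G}"
    unfolding determined_utility_def using G utility_laws_over[OF wf]
    by (fastforce simp: sat_map_form s_def)
  moreover have "I = (\<Union>i\<le>1. stamp_set i (s i)) \<union> (\<Union>i<1. stamp_set i (a \<union> p))"
    unfolding I_def s_def by (auto simp: atMost_Suc)
  ultimately have run: "I \<union> determined_utility D I = run_model D 1 {} s (\<lambda>_. a) (\<lambda>_. p)"
    unfolding run_model_def by auto
  have "pf_transition D x a y p \<longleftrightarrow> transition D x a y \<and> run_model D 1 {} s (\<lambda>_. a) (\<lambda>_. p) \<in> SM (D_prog D 1)"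
    unfolding pf_transition_def Let_def I_def[symmetric] run using p by simp
  also have "\<dots> \<longleftrightarrow> run_model D 1 {} s (\<lambda>_. a) (\<lambda>_. p) \<in> SM (D_prog D 1)"
    using transition_of_run[OF asg] unfolding s_def by auto
  also have "\<dots> \<longleftrightarrow> is_step D (x \<union> a \<union> p) y"
    using SM_D_prog_iff[OF asg] x unfolding states_eq s_def by simp
  finally show ?thesis .
qed

text \<open>After exchanging the sums, each pf assignment counts for exactly one successor, by the
  second standing assumption; its premises on the action come from
  \<open>act_interpsD\<close>.\<close>

lemma sum_step_prob:
  assumes sa: "standing_assumptions D" and x: "x \<in> states D" and a: "a \<in> act_interps D"
  shows "(\<Sum>y\<in>states D. step_prob D x a y) = 1"
proof -
  let ?P = "assignments D (pfs D)"
  note act = act_interpsD[OF sa a]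
  have finP: "finite ?P"
    by (rule wf_finite_assignments(3)[OF wf])
  have finS: "finite (states D)"
    unfolding states_eq by (rule finite_runs(2)[OF wf])
  have ex1: "\<exists>!y. y \<in> states D \<and> is_step D (x \<union> a \<union> p) y" if "p \<in> ?P" for p
  proof -
    have "\<exists>!y. y \<in> states D \<and> pf_transition D x a y p"
      by (rule ex1_pf_transition[OF sa x act(1) that act(2)])
    then show ?thesis
      using pf_transition_iff_is_step[OF x act(1) that] by (metis (no_types, lifting))
  qed
  have "(\<Sum>y\<in>states D. step_prob D x a y) =
      (\<Sum>y\<in>states D. \<Sum>p\<in>?P. if is_step D (x \<union> a \<union> p) y then assignment_prob D p else 0)"
    unfolding step_prob_def using finP by (simp add: sum.inter_filter)
  also have "\<dots> = (\<Sum>p\<in>?P. \<Sum>y\<in>states D. if is_step D (x \<union> a \<union> p) y then assignment_prob D p else 0)"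
    by (rule sum.swap)
  also have "\<dots> = (\<Sum>p\<in>?P. assignment_prob D p)"
  proof (rule sum.cong)
    fix p assume "p \<in> ?P"
    then obtain y where y: "y \<in> states D \<and> is_step D (x \<union> a \<union> p) y"
      and uniq: "\<forall>z. z \<in> states D \<and> is_step D (x \<union> a \<union> p) z \<longrightarrow> z = y"
      using ex1 by (elim ex1E[OF ex1])
    have eq: "is_step D (x \<union> a \<union> p) z \<longleftrightarrow> z = y" if "z \<in> states D" for z
      using y uniq that by blast
    have "(\<Sum>z\<in>states D. if is_step D (x \<union> a \<union> p) z then assignment_prob D p else 0) =
        (\<Sum>z\<in>states D. if z = y then assignment_prob D p else 0)"
      by (intro sum.cong refl) (simp only: eq)
    then show "(\<Sum>z\<in>states D. if is_step D (x \<union> a \<union> p) z then assignment_prob D p else 0) = assignment_prob D p"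
      using finS y by simp
  qed simp
  also have "\<dots> = 1"
    using wf_finite(3)[OF wf] sum_prob[OF wf] finite_Dom[OF wf] by (intro sum_assignment_prob) auto
  finally show ?thesis .
qed

end

lemma gain_forget_init [simp]: "gain (forget_init D) = gain D"
  by (intro ext) (simp only: gain_def forget_init_simps)

text \<open>Without initpf constants only the empty assignment is left, and its mass is the empty
  product.\<close>

lemma init_mass_forget_init [simp]: "init_mass (forget_init D) x = 1"
proof -
  have "{q. q \<in> assignments D {} \<and> init_ok (forget_init D) (x \<union> q)} = {{}}"
    by auto
  then show ?thesis
    by (simp add: init_mass_def assignment_prob_def)
qed

text \<open>Consistency provides a stable model at horizon 0. Its initpf part is admissible for
  \<open>s0\<close>, and declared probabilities are strictly positive.\<close>

lemma init_mass_pos: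
  assumes wf: "wf_action_desc D" and "s0 \<in> states D" and "consistent_with_init D s0"
  shows "0 < init_mass D s0"
proof -
  obtain I where I: "I \<in> SM (Tr D 0)" and sat: "I \<Turnstile> stamp_conj 0 s0"
    using assms(3) unfolding consistent_with_init_def Tr_def by (auto simp: Un_commute)
  obtain q s e p where asg: "assigned D 0 q s e p" and eq: "I = run_model D 0 q s e p"
    using ex_run_of_SM_Tr[OF wf I] by blast
  have "s0 \<in> assignments D (fluents D)"
    using assms(2) unfolding states_eq[OF wf] is_state_def by blast
  then have "s 0 = s0"
    using sat sat_stamp_conj_fluents[OF wf asg, of 0 s0] unfolding eq by simp
  then have "init_ok D (s0 \<union> q)"
    using I run_model_in_SM_Tr_iff[OF wf asg] unfolding eq by simp
  moreover have "q \<in> assignments D (initpfs D)"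
    using asg unfolding assigned_def by blast
  ultimately show ?thesis
    unfolding init_mass_def using wf_finite_assignments(1)[OF wf] assignment_prob_pos[OF wf]
    by (intro sum_pos2[of _ q]) (auto intro: less_imp_le)
qed

section \<open>Transition probabilities, rewards and equality of the objectives\<close>

context
  fixes D :: "('c, 'v) action_desc"
  assumes wf: "wf_action_desc D" and sa: "standing_assumptions D"
begin

text \<open>\<open>C\<close> is left open to serve both the denominator, where it is trivial, and
  the numerators, where it fixes the successor state.\<close>

lemma sum_SM_D_prog_1:
  assumes x: "x \<in> states D" and a: "a \<in> act_interps D"
    and A: "\<And>I. I \<Turnstile> A \<longleftrightarrow> I \<Turnstile> stamp_conj 0 x \<and> I \<Turnstile> stamp_conj 0 a \<and> I \<Turnstile> C"
    and C: "\<And>s e p. assigned (forget_init D) 1 {} s e p \<Longrightarrow> run_model D 1 {} s e p \<Turnstile> C \<longleftrightarrow> B s"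
  shows "(\<Sum>I | I \<in> SM (D_prog D 1) \<and> I \<Turnstile> A. weight_of (D_prog D 1) I) =
      (\<Sum>s | s \<in> {0..1::nat} \<rightarrow>\<^sub>E states D \<and> s 0 = x \<and> B s. step_prob D x a (s 1))"
    and "(\<Sum>I | I \<in> SM (D_prog D 1) \<and> I \<Turnstile> A. utility_of I * weight_of (D_prog D 1) I) =
      (\<Sum>s | s \<in> {0..1::nat} \<rightarrow>\<^sub>E states D \<and> s 0 = x \<and> B s.
         gain D (x \<union> a) (s 1) * step_prob D x a (s 1))"
proof -
  let ?D = "forget_init D"
  note act = act_interpsD(1)[OF wf sa a]
  have xs: "x \<in> assignments D (fluents D)"
    using x unfolding states_eq[OF wf] is_state_def by blast
  have sat: "run_model ?D 1 q s e p \<Turnstile> A \<longleftrightarrow> s 0 = x \<and> (\<forall>i<1. e i = a) \<and> B s"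
    and util: "run_model ?D 1 q s e p \<Turnstile> A \<Longrightarrow>
      utility_of (run_model ?D 1 q s e p) = gain D (x \<union> a) (s 1)"
    if "((q, s), (e, p)) \<in> runs ?D 1" for q s e p
  proof -
    note asg = assigned_of_run[OF that]
    have q: "q = {}"
      using asg unfolding assigned_def by simp
    show sat: "run_model ?D 1 q s e p \<Turnstile> A \<longleftrightarrow> s 0 = x \<and> (\<forall>i<1. e i = a) \<and> B s"
      using sat_stamp_conj_fluents[OF wf_forget_init[OF wf] asg, of 0 x]
        sat_stamp_conj_actions[OF wf_forget_init[OF wf] asg, of 0 a] xs act C asg A
      unfolding q by simp
    show "utility_of (run_model ?D 1 q s e p) = gain D (x \<union> a) (s 1)"
      if "run_model ?D 1 q s e p \<Turnstile> A"
      using that unfolding sat utility_of_run_model[OF wf_forget_init[OF wf]] by simp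
  qed
  have "(\<Sum>I | I \<in> SM (Tr ?D 1) \<and> I \<Turnstile> A. weight_of (Tr ?D 1) I) = init_mass ?D x *
    (\<Sum>s | s \<in> {0..1::nat} \<rightarrow>\<^sub>E Collect (is_state ?D) \<and> s 0 = x \<and> B s.
       1 * (\<Prod>i<1. step_prob ?D (s i) a (s (Suc i))))"
    using sat act by (intro sum_SM_Tr[OF wf_forget_init[OF wf], where \<pi> = "\<lambda>_. a"]) auto
  also have "\<dots> = (\<Sum>s | s \<in> {0..1::nat} \<rightarrow>\<^sub>E states D \<and> s 0 = x \<and> B s. step_prob D x a (s 1))"
    unfolding states_eq[OF wf] by (auto intro!: sum.cong)
  finally show "(\<Sum>I | I \<in> SM (D_prog D 1) \<and> I \<Turnstile> A. weight_of (D_prog D 1) I) =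
      (\<Sum>s | s \<in> {0..1::nat} \<rightarrow>\<^sub>E states D \<and> s 0 = x \<and> B s. step_prob D x a (s 1))"
    unfolding D_prog_eq_Tr .
  have "(\<Sum>I | I \<in> SM (Tr ?D 1) \<and> I \<Turnstile> A. utility_of I * weight_of (Tr ?D 1) I) = init_mass ?D x *
    (\<Sum>s | s \<in> {0..1::nat} \<rightarrow>\<^sub>E Collect (is_state ?D) \<and> s 0 = x \<and> B s.
       gain D (x \<union> a) (s 1) * (\<Prod>i<1. step_prob ?D (s i) a (s (Suc i))))"
    using sat act util by (intro sum_SM_Tr[OF wf_forget_init[OF wf], where \<pi> = "\<lambda>_. a"]) auto
  also have "\<dots> = (\<Sum>s | s \<in> {0..1::nat} \<rightarrow>\<^sub>E states D \<and> s 0 = x \<and> B s.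
         gain D (x \<union> a) (s 1) * step_prob D x a (s 1))"
    unfolding states_eq[OF wf] by (auto intro!: sum.cong)
  finally show "(\<Sum>I | I \<in> SM (D_prog D 1) \<and> I \<Turnstile> A. utility_of I * weight_of (D_prog D 1) I) =
      (\<Sum>s | s \<in> {0..1::nat} \<rightarrow>\<^sub>E states D \<and> s 0 = x \<and> B s.
         gain D (x \<union> a) (s 1) * step_prob D x a (s 1))"
    unfolding D_prog_eq_Tr .
qed

text \<open>The one-step runs from \<open>x\<close> under \<open>a\<close> have total weight 1, so
  the transition probability is an unnormalised weight. The reward also conditions on the successor;
  if that has mass 0, division by 0 makes it 0 instead of the gain.\<close>

lemma mdp_of_trans_reward:
  assumes x: "x \<in> states D" and a: "a \<in> act_interps D" and y: "y \<in> states D"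
  shows "mdp_trans (mdp_of D) x a y = step_prob D x a y"
    and "mdp_reward (mdp_of D) x a y = (if step_prob D x a y = 0 then 0 else gain D (x \<union> a) y)"
proof -
  have fin: "finite (SM (D_prog D 1))"
    unfolding D_prog_eq_Tr by (rule finite_SM_Tr[OF wf_forget_init[OF wf]])
  have finS: "finite (states D)"
    unfolding states_eq[OF wf] by (rule finite_runs(2)[OF wf])
  have ys: "y \<in> assignments D (fluents D)"
    using y unfolding states_eq[OF wf] is_state_def by blast
  have C: "run_model D 1 {} s e p \<Turnstile> stamp_conj 1 y \<longleftrightarrow> s 1 = y"
    if "assigned (forget_init D) 1 {} s e p" for s e p
    using sat_stamp_conj_fluents[OF wf_forget_init[OF wf] that, of 1 y] ys by simp
  \<comment> \<open>With both endpoints fixed there is a single extensional path, so sums over paths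
    collapse to one term.\<close>
  define t where "t = (\<lambda>i\<in>{0..1::nat}. if i = 0 then x else y)"
  have single: "{s. s \<in> {0..1::nat} \<rightarrow>\<^sub>E states D \<and> s 0 = x \<and> s 1 = y} = {t}"
  proof -
    have "s = t" if s: "s \<in> {0..1::nat} \<rightarrow>\<^sub>E states D" "s 0 = x" "s 1 = y" for s
    proof (rule extensionalityI[of _ "{0..1}"])
      fix i :: nat assume "i \<in> {0..1}"
      then have "i = 0 \<or> i = 1" by auto
      then show "s i = t i" using s(2,3) unfolding t_def by auto
    qed (use s(1) in \<open>auto simp: PiE_def t_def\<close>)
    moreover have "t \<in> {0..1::nat} \<rightarrow>\<^sub>E states D"
      using x y unfolding t_def by (auto simp: PiE_iff)
    ultimately show ?thesis
      unfolding t_def by auto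
  qed
  \<comment> \<open>The one-step case of \<open>sum_prod_paths\<close>, for the kernel that always
    takes action \<open>a\<close>.\<close>
  have "(\<Sum>s | s \<in> {0..1::nat} \<rightarrow>\<^sub>E states D \<and> s 0 = x. step_prob D x a (s 1)) =
      (\<Sum>s | s \<in> {0..1::nat} \<rightarrow>\<^sub>E states D \<and> s 0 = x. \<Prod>i<1. step_prob D (s i) a (s (Suc i)))"
    by (intro sum.cong) auto
  also have "\<dots> = 1"
    using sum_step_prob[OF wf sa] a x finS
    by (intro sum_prod_paths[where k = "\<lambda>_ x. step_prob D x a"]) auto
  finally have one: "(\<Sum>s | s \<in> {0..1::nat} \<rightarrow>\<^sub>E states D \<and> s 0 = x. step_prob D x a (s 1)) = 1" .
  have den: "(\<Sum>I | I \<in> SM (D_prog D 1) \<and> I \<Turnstile> And (stamp_conj 0 x) (stamp_conj 0 a).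
      weight_of (D_prog D 1) I) = 1"
    using sum_SM_D_prog_1(1)[OF x a, of "And (stamp_conj 0 x) (stamp_conj 0 a)" Top "\<lambda>_. True"] one
    by simp
  have weight: "(\<Sum>I | I \<in> SM (D_prog D 1) \<and> I \<Turnstile> A. weight_of (D_prog D 1) I) = step_prob D x a y"
    and utility: "(\<Sum>I | I \<in> SM (D_prog D 1) \<and> I \<Turnstile> A. utility_of I * weight_of (D_prog D 1) I) =
      gain D (x \<union> a) y * step_prob D x a y"
    if A: "\<And>I. I \<Turnstile> A \<longleftrightarrow> I \<Turnstile> stamp_conj 0 x \<and> I \<Turnstile> stamp_conj 0 a \<and> I \<Turnstile> stamp_conj 1 y" for A
  proof -
    have "(\<Sum>I | I \<in> SM (D_prog D 1) \<and> I \<Turnstile> A. weight_of (D_prog D 1) I) =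
        (\<Sum>s | s \<in> {0..1::nat} \<rightarrow>\<^sub>E states D \<and> s 0 = x \<and> s 1 = y. step_prob D x a (s 1))"
      by (rule sum_SM_D_prog_1(1)[OF x a A]) (rule C)
    then show "(\<Sum>I | I \<in> SM (D_prog D 1) \<and> I \<Turnstile> A. weight_of (D_prog D 1) I) = step_prob D x a y"
      unfolding single by (simp add: t_def)
    have "(\<Sum>I | I \<in> SM (D_prog D 1) \<and> I \<Turnstile> A. utility_of I * weight_of (D_prog D 1) I) =
        (\<Sum>s | s \<in> {0..1::nat} \<rightarrow>\<^sub>E states D \<and> s 0 = x \<and> s 1 = y.
           gain D (x \<union> a) (s 1) * step_prob D x a (s 1))"
      by (rule sum_SM_D_prog_1(2)[OF x a A]) (rule C)
    then show "(\<Sum>I | I \<in> SM (D_prog D 1) \<and> I \<Turnstile> A. utility_of I * weight_of (D_prog D 1) I) =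
        gain D (x \<union> a) y * step_prob D x a y"
      unfolding single by (simp add: t_def)
  qed
  have num: "(\<Sum>I | I \<in> SM (D_prog D 1) \<and> I \<Turnstile>
        And (stamp_conj 1 y) (And (stamp_conj 0 x) (stamp_conj 0 a)). weight_of (D_prog D 1) I) =
      step_prob D x a y"
    by (rule weight) auto
  show "mdp_trans (mdp_of D) x a y = step_prob D x a y"
    unfolding mdp_of_def using cond_prob_form_eq[OF fin] num den by simp
  let ?A = "And (And (stamp_conj 0 x) (stamp_conj 0 a)) (stamp_conj 1 y)"
  have "(\<Sum>I | I \<in> SM (D_prog D 1) \<and> I \<Turnstile> ?A. weight_of (D_prog D 1) I) = step_prob D x a y"
    by (rule weight) auto
  moreover have "(\<Sum>I | I \<in> SM (D_prog D 1) \<and> I \<Turnstile> ?A. utility_of I * weight_of (D_prog D 1) I) =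
      gain D (x \<union> a) y * step_prob D x a y"
    by (rule utility) auto
  ultimately show "mdp_reward (mdp_of D) x a y =
      (if step_prob D x a y = 0 then 0 else gain D (x \<union> a) y)"
    unfolding mdp_of_def using expected_utility_eq[OF fin, of ?A] by simp
qed

text \<open>Numerator and denominator share the positive factor \<open>init_mass D s0\<close>, and
  the path sum in the denominator is 1.\<close>

lemma expected_utility_eq_ER:
  assumes s0: "s0 \<in> states D" and cons: "consistent_with_init D s0" and \<pi>: "\<pi> \<in> policies D m"
  shows "expected_utility (Tr D m) (And (policy_form D m \<pi>) (stamp_conj 0 s0)) =
     ER (mdp_of D) m \<pi> s0"
proof -
  let ?A = "And (policy_form D m \<pi>) (stamp_conj 0 s0)"
  let ?P = "{s. s \<in> {0..m} \<rightarrow>\<^sub>E states D \<and> s 0 = s0}"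
  let ?t = "\<lambda>s i. step_prob D (s i) (\<pi> (s i, i)) (s (Suc i))"
  let ?g = "\<lambda>s i. gain D (s i \<union> \<pi> (s i, i)) (s (Suc i))"
  have finS: "finite (states D)"
    unfolding states_eq[OF wf] by (rule finite_runs(2)[OF wf])
  have pol: "\<pi> (x, i) \<in> act_interps D" if "x \<in> states D" "i < m" for x i
    using \<pi> that unfolding policies_def by (auto simp: PiE_iff)
  have state_asg: "x \<in> assignments D (fluents D)" if "x \<in> states D" for x
    using that unfolding states_eq[OF wf] is_state_def by blast
  have sat: "run_model D m q s e p \<Turnstile> ?A \<longleftrightarrow> s 0 = s0 \<and> (\<forall>i<m. e i = \<pi> (s i, i)) \<and> True"
    if run: "((q, s), (e, p)) \<in> runs D m" for q s e p
  proof -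
    let ?I = "run_model D m q s e p"
    note asg = assigned_of_run[OF run]
    have s: "s i \<in> states D" if "i \<le> m" for i
      using run that unfolding runs_def states_eq[OF wf] by (auto simp: PiE_iff)
    have "{Imp (stamp_conj i x) (stamp_conj i (\<pi> (x, i))) | x i. x \<in> states D \<and> i < m} =
        (\<lambda>(x, i). Imp (stamp_conj i x) (stamp_conj i (\<pi> (x, i)))) ` (states D \<times> {..<m})"
      by auto
    then have "?I \<Turnstile> policy_form D m \<pi> \<longleftrightarrow>
        (\<forall>x\<in>states D. \<forall>i<m. ?I \<Turnstile> stamp_conj i x \<longrightarrow> ?I \<Turnstile> stamp_conj i (\<pi> (x, i)))"
      unfolding policy_form_def using finS by (simp add: sat_BigAnd lessThan_def)
    also have "\<dots> \<longleftrightarrow> (\<forall>x\<in>states D. \<forall>i<m. s i = x \<longrightarrow> e i = \<pi> (x, i))"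
      using sat_stamp_conj_fluents[OF wf asg] sat_stamp_conj_actions[OF wf asg] state_asg
        act_interpsD(1)[OF wf sa pol] by simp
    \<comment> \<open>Only the state \<open>s i\<close> triggers an implication at time
      \<open>i\<close>, so the formula fixes the actions along the path and nothing else.\<close>
    also have "\<dots> \<longleftrightarrow> (\<forall>i<m. e i = \<pi> (s i, i))"
      using s by (metis less_imp_le)
    finally show ?thesis
      using sat_stamp_conj_fluents[OF wf asg, of 0 s0] state_asg[OF s0] by auto
  qed
  have util: "utility_of (run_model D m q s e p) = (\<Sum>i<m. ?g s i)"
    if "((q, s), (e, p)) \<in> runs D m" "run_model D m q s e p \<Turnstile> ?A" for q s e p
    using that(2) unfolding sat[OF that(1)] utility_of_run_model[OF wf] by simp
  have act: "\<pi> (x, i) \<in> assignments D (actions D)" if "is_state D x" "i < m" for x i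
    using act_interpsD(1)[OF wf sa pol] that unfolding states_eq[OF wf] by blast
  have "(\<Sum>I | I \<in> SM (Tr D m) \<and> I \<Turnstile> ?A. weight_of (Tr D m) I) = init_mass D s0 *
    (\<Sum>s | s \<in> {0..m} \<rightarrow>\<^sub>E Collect (is_state D) \<and> s 0 = s0 \<and> True. 1 * (\<Prod>i<m. ?t s i))"
    by (intro sum_SM_Tr[OF wf act sat]) auto
  \<comment> \<open>Row sums are 1 at every time, so the policy leaves no trace in the
    denominator.\<close>
  moreover have "(\<Sum>s\<in>?P. \<Prod>i<m. ?t s i) = 1"
    using sum_step_prob[OF wf sa] pol s0 finS
    by (intro sum_prod_paths[where k = "\<lambda>i x. step_prob D x (\<pi> (x, i))"]) auto
  ultimately have den: "(\<Sum>I | I \<in> SM (Tr D m) \<and> I \<Turnstile> ?A. weight_of (Tr D m) I) = init_mass D s0"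
    unfolding states_eq[OF wf] by simp
  have "(\<Sum>I | I \<in> SM (Tr D m) \<and> I \<Turnstile> ?A. utility_of I * weight_of (Tr D m) I) = init_mass D s0 *
    (\<Sum>s | s \<in> {0..m} \<rightarrow>\<^sub>E Collect (is_state D) \<and> s 0 = s0 \<and> True.
       (\<Sum>i<m. ?g s i) * (\<Prod>i<m. ?t s i))"
    by (intro sum_SM_Tr[OF wf act sat]) (simp_all add: util)
  then have "expected_utility (Tr D m) ?A = (\<Sum>s\<in>?P. (\<Sum>i<m. ?g s i) * (\<Prod>i<m. ?t s i))"
    using expected_utility_eq[OF finite_SM_Tr[OF wf], of m ?A] init_mass_pos[OF wf s0 cons]
    unfolding den states_eq[OF wf] by simp
  also have "\<dots> = ER (mdp_of D) m \<pi> s0"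
  proof -
    have "(\<Sum>i<m. ?g s i) * (\<Prod>i<m. ?t s i) =
        (\<Sum>i<m. mdp_reward (mdp_of D) (s i) (\<pi> (s i, i)) (s (i + 1))) *
        (\<Prod>i<m. mdp_trans (mdp_of D) (s i) (\<pi> (s i, i)) (s (i + 1)))"
      if "s \<in> ?P" for s
    proof -
      have s: "s i \<in> states D" if "i \<le> m" for i
        using \<open>s \<in> ?P\<close> that by (auto simp: PiE_iff)
      have mdp: "mdp_trans (mdp_of D) (s i) (\<pi> (s i, i)) (s (i + 1)) = ?t s i"
        "mdp_reward (mdp_of D) (s i) (\<pi> (s i, i)) (s (i + 1)) = (if ?t s i = 0 then 0 else ?g s i)"
        if "i < m" for i
        using mdp_of_trans_reward[OF s pol[OF s] s] that by simp_all
      show ?thesis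
      \<comment> \<open>If some step has probability 0, rewards may differ from gains, but both
        products vanish.\<close>
      proof (cases "\<exists>i<m. ?t s i = 0")
        case True
        then have "(\<Prod>i<m. ?t s i) = 0"
          by (intro prod_zero) auto
        then show ?thesis
          using mdp(1) by simp
      next
        case False
        then show ?thesis
          using mdp by simp
      qed
    qed
    then show ?thesis
      unfolding ER_def by (intro sum.cong) (simp_all add: mdp_of_def)
  qed
  finally show ?thesis .
qed

end

theorem theorem4:
  fixes D :: "('c, 'v) action_desc" and m :: nat and s0 :: "('c, 'v) interp"
  assumes "wf_action_desc D"
    and "standing_assumptions D"
    and "s0 \<in> states D"
    and "consistent_with_init D s0"
  shows "argmax (\<lambda>\<pi>. expected_utility (Tr D m) (And (policy_form D m \<pi>) (stamp_conj 0 s0)))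
           (policies D m)
       = argmax (\<lambda>\<pi>. ER (mdp_of D) m \<pi> s0) (policies D m)"
  \<comment> \<open>A maximiser and its competitors both lie in \<open>policies D m\<close>, where
    the objectives coincide; hence the rewriting under the membership conjunct.\<close>
  unfolding argmax_def is_arg_max_def
  using expected_utility_eq_ER[OF assms(1-4)] by (simp cong: conj_cong)

end
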